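(* Let $p$ be a prime and let $A \subseteq \mathbb{F}_p^*$ with $|A| = \alpha p$ be sum-free (i.e. $A \cap (A+A) = \varnothing$) and satisfy $A = A^*$. Then $\alpha \leqslant 1/9 + o(1)$ as $p \to \infty$.
   Context: $\mathbb{F}_p^* = \mathbb{F}_p\setminus\{0\}$, $A^* = \{a^{-1}: a\in A\}$, and $A + A = \{a+b : a,b\in A\}$. *)

theory Defs
  imports "HOL-Number_Theory.Residues" "HOL-Library.Landau_Symbols"
begin

text \<open>
  The size of the field has to be quantified inside the statement (the error term must not depend
  on anything but the prime), so the prime field is a carrier-based ring whose elements are the
  integers in \<open>{0..p - 1}\<close>, not a type.
\<close>

abbreviation prime_field :: "nat \<Rightarrow> int ring" where
  "prime_field p \<equiv> residue_ring (int p)"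

definition sum_free :: "('a, 'm) ring_scheme \<Rightarrow> 'a set \<Rightarrow> bool" where
  "sum_free R A \<longleftrightarrow> A \<inter> (A <+>\<^bsub>R\<^esub> A) = {}"

definition inverse_set :: "('a, 'm) monoid_scheme \<Rightarrow> 'a set \<Rightarrow> 'a set" where
  "inverse_set R A = (\<lambda>a. inv\<^bsub>R\<^esub> a) ` A"

end

theory Submission
  imports Defs "HOL-Analysis.Convex" "HOL-Library.Nonpos_Ints" "HOL-Real_Asymp.Real_Asymp"
begin

text \<open>
  Write \<open>1\<^sub>A\<close> for the indicator function of \<open>A\<close>. Convolve it with a probability density
  \<open>\<mu>\<close> that has nonnegative Fourier coefficients of bounded sum, all close to \<open>1\<close> at the large
  frequencies of \<open>1\<^sub>A\<close>. The resulting \<open>f\<close> has almost no Schur triples, because \<open>A\<close> has none, and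
  it is at least \<open>\<epsilon>\<close> on all but \<open>\<epsilon> p\<close> elements of \<open>A\<close>. So \<open>g = 1 - (1 - f)^N\<close> is close to \<open>1\<close> on
  most of \<open>A\<close> and still has almost no Schur triples; by Pollard's theorem its mean is at most
  \<open>1/3 + o(1)\<close>. As the Fourier coefficients of \<open>g\<close> are absolutely summable with a bound independent
  of \<open>p\<close>, Kloosterman's bound shows that \<open>g x\<close> and \<open>g (1/x)\<close> are asymptotically independent.
  Since \<open>A\<close> is closed under inversion, both are close to \<open>1\<close> on most of \<open>A\<close>, whence
  \<open>\<alpha> \<le> (1/3)^2 + o(1)\<close>.
\<close>

subsection \<open>Fourier analysis on the integers modulo p\<close>

text \<open>The Kloosterman estimate is useful only for functions whose Wiener norm is bounded,
  while the norm of an indicator can be of order sqrt p. So neither \<open>A\<close> nor the level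
  set where \<open>f\<close> is at least \<epsilon> can be fed into it. The polynomial 1 - (1 - f)^N
  imitates the indicator of that level set on \<open>A\<close> and keeps a bounded norm; being at
  most N f, it also keeps the Schur sum small. Nonnegative coefficients of \<mu> serve three
  purposes: their sum is simply the value of \<mu> at 0, the mean of a product is at least the
  product of the means (which bounds the normalising factor independently of p), and the zero
  frequency alone already prevents \<open>f\<close> from being small on many elements of
  \<open>A\<close>. The density 1/3 is where Cauchy-Davenport forces a set to meet its own sumset;
  Pollard's theorem is the counting form of this. On the inversion side any power saving over p
  beats a bounded Wiener norm, so the elementary fourth moment bound p^(3/4) for Kloosterman sums is
  enough and Weil's p^(1/2) is avoided.\<close>

locale cyclic_fourier =
  fixes p :: nat
  assumes p_pos: "p > 0"
begin

abbreviation Zp :: "int set" where "Zp \<equiv> {0..<int p}"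

text \<open>Functions on the residues modulo \<open>p\<close> are periodic functions on all
  integers, so that arguments such as \<open>x + y\<close> or \<open>r - s\<close> need no
  reduction.\<close>

definition per :: "(int \<Rightarrow> 'a) \<Rightarrow> bool" where
  "per h \<longleftrightarrow> (\<forall>x. h (x mod int p) = h x)"

definition e :: "int \<Rightarrow> complex" where
  "e x = cis (2 * pi * (of_int x / of_nat p))"

text \<open>The factor 1/p sits here, not in the inversion formula: coefficient 0 is the mean, and
  coefficients of functions bounded by 1 are bounded by 1.\<close>

definition hat :: "(int \<Rightarrow> complex) \<Rightarrow> int \<Rightarrow> complex" where
  "hat h r = (\<Sum>x\<in>Zp. h x * e (- (r * x))) / of_nat p"

text \<open>The norm of the Wiener algebra. It measures how much a function can amplify an error
  that is uniform over all frequencies.\<close>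

definition wiener :: "(int \<Rightarrow> complex) \<Rightarrow> real" where
  "wiener h = (\<Sum>r\<in>Zp. norm (hat h r))"

definition posdef :: "(int \<Rightarrow> complex) \<Rightarrow> bool" where
  "posdef h \<longleftrightarrow> (\<forall>r. hat h r \<in> \<real>\<^sub>\<ge>\<^sub>0)"

lemma perD: "per h \<Longrightarrow> h (x mod int p) = h x"
  by (simp add: per_def)

lemma per_cong: "per h \<Longrightarrow> x mod int p = y mod int p \<Longrightarrow> h x = h y"
  by (metis perD)

lemma sum_reindex_mod:
  fixes h :: "int \<Rightarrow> 'a :: comm_monoid_add"
  assumes "per h" and "inj_on (\<lambda>x. u x mod int p) Zp"
  shows "(\<Sum>x\<in>Zp. h (u x)) = (\<Sum>x\<in>Zp. h x)"
proof -
  have "(\<lambda>x. u x mod int p) ` Zp = Zp"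
    using p_pos by (intro endo_inj_surj assms) auto
  then have "bij_betw (\<lambda>x. u x mod int p) Zp Zp"
    using assms by (simp add: bij_betw_def)
  from sum.reindex_bij_betw[OF this, of h] show ?thesis
    using assms(1) by (simp add: per_def)
qed

lemma sum_shift:
  fixes h :: "int \<Rightarrow> 'a :: comm_monoid_add"
  assumes "per h"
  shows "(\<Sum>x\<in>Zp. h (x + a)) = (\<Sum>x\<in>Zp. h x)"
proof (rule sum_reindex_mod[OF assms])
  show "inj_on (\<lambda>x. (x + a) mod int p) Zp"
  proof (rule inj_onI)
    fix x y assume "x \<in> Zp" "y \<in> Zp" "(x + a) mod int p = (y + a) mod int p"
    then show "x = y"
      by (metis add_diff_cancel_right' atLeastLessThan_iff mod_diff_left_eq mod_pos_pos_trivial)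
  qed
qed

lemma e_add: "e (x + y) = e x * e y"
  by (simp add: e_def cis_mult ring_distribs add_divide_distrib)

lemma e_0 [simp]: "e 0 = 1"
  by (simp add: e_def)

lemma norm_e [simp]: "norm (e x) = 1"
  by (simp add: e_def)

lemma cnj_e [simp]: "cnj (e x) = e (- x)"
  by (simp add: e_def cis_cnj)

lemma e_eq_1_iff: "e x = 1 \<longleftrightarrow> int p dvd x"
proof
  assume "int p dvd x"
  then obtain k where "x = int p * k" by blast
  then have "e x = cis (2 * pi * of_int k)"
    using p_pos by (simp add: e_def)
  then show "e x = 1" by simp
next
  assume "e x = 1"
  then have "cos (2 * pi * (of_int x / of_nat p)) = 1"
    by (simp add: e_def complex_eq_iff)
  then obtain n :: int where "2 * pi * (of_int x / of_nat p) = of_int n * 2 * pi"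
    by (auto simp: cos_one_2pi_int)
  then have "of_int x = (of_int (n * int p) :: real)"
    using p_pos by (simp add: field_simps)
  then show "int p dvd x" by (simp only: of_int_eq_iff) simp
qed

lemma e_cong: "x mod int p = y mod int p \<Longrightarrow> e x = e y"
proof -
  assume "x mod int p = y mod int p"
  then have "int p dvd x - y" by (simp add: mod_eq_dvd_iff)
  then have "e (x - y) = 1" by (simp add: e_eq_1_iff)
  then show ?thesis using e_add[of "x - y" y] by simp
qed

lemma per_e: "per (\<lambda>x. e (r * x))"
  unfolding per_def by (intro allI e_cong) (simp add: mod_mult_right_eq)

lemma per_mult: "per h \<Longrightarrow> per g \<Longrightarrow> per (\<lambda>x. h x * g x)"
  by (simp add: per_def)

text \<open>The shift from \<open>x\<close> to \<open>x + 1\<close> preserves the sum and multiplies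
  it by \<open>e r\<close>, which is 1 only if \<open>p\<close> divides \<open>r\<close>.\<close>

lemma sum_e: "(\<Sum>x\<in>Zp. e (r * x)) = (if int p dvd r then of_nat p else 0)"
proof (cases "int p dvd r")
  case True
  then have "e (r * x) = 1" for x
    by (simp add: e_eq_1_iff)
  then show ?thesis using True by simp
next
  case False
  let ?s = "\<Sum>x\<in>Zp. e (r * x)"
  have "?s = (\<Sum>x\<in>Zp. e (r * (x + 1)))"
    by (rule sum_shift[OF per_e, symmetric])
  also have "\<dots> = ?s * e r"
    by (simp add: ring_distribs e_add sum_distrib_right)
  finally have "?s * (e r - 1) = 0"
    by (simp add: algebra_simps)
  then show ?thesis using False by (simp add: e_eq_1_iff)
qed

lemma fourier_inversion:
  assumes "per h"
  shows "h x = (\<Sum>r\<in>Zp. hat h r * e (r * x))"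
proof -
  have *: "int p dvd x - y \<longleftrightarrow> y = x mod int p" if "y \<in> Zp" for y
    using that by (metis atLeastLessThan_iff mod_eq_dvd_iff mod_pos_pos_trivial)
  have "(\<Sum>r\<in>Zp. hat h r * e (r * x))
      = (\<Sum>r\<in>Zp. \<Sum>y\<in>Zp. h y * e ((x - y) * r) / of_nat p)"
    unfolding hat_def sum_divide_distrib sum_distrib_right
    by (intro sum.cong refl) (simp add: algebra_simps flip: e_add)
  also have "\<dots> = (\<Sum>y\<in>Zp. h y * (\<Sum>r\<in>Zp. e ((x - y) * r)) / of_nat p)"
    by (subst sum.swap) (simp add: sum_distrib_left sum_divide_distrib)
  also have "\<dots> = (\<Sum>y\<in>Zp. if y = x mod int p then h y else 0)"
    using p_pos by (intro sum.cong refl) (simp add: sum_e *)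
  also have "\<dots> = h (x mod int p)"
    using p_pos by simp
  finally show ?thesis using assms by (simp add: per_def)
qed

lemma hat_cong: "r mod int p = s mod int p \<Longrightarrow> hat h r = hat h s"
  unfolding hat_def
  by (intro arg_cong2[where f = "(/)"] sum.cong refl arg_cong2[where f = "(*)"] e_cong)
     (metis mod_minus_cong mod_mult_left_eq)

lemma per_hat: "per (hat h)"
  unfolding per_def by (intro allI hat_cong) simp

lemma hat_0: "hat h 0 = (\<Sum>x\<in>Zp. h x) / of_nat p"
  by (simp add: hat_def)

lemma sum_hat: "(\<Sum>x\<in>Zp. h x * e (- (r * x))) = of_nat p * hat h r"
  using p_pos by (simp add: hat_def)

lemma plancherel:
  assumes "per g"
  shows "(\<Sum>x\<in>Zp. h x * cnj (g x)) = of_nat p * (\<Sum>r\<in>Zp. hat h r * cnj (hat g r))"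
proof -
  have "(\<Sum>x\<in>Zp. h x * cnj (g x))
      = (\<Sum>x\<in>Zp. \<Sum>r\<in>Zp. cnj (hat g r) * (h x * e (- (r * x))))"
    by (subst fourier_inversion[OF assms]) (simp add: sum_distrib_left mult_ac)
  also have "\<dots> = of_nat p * (\<Sum>r\<in>Zp. hat h r * cnj (hat g r))"
    by (subst sum.swap, subst sum_distrib_left[symmetric], unfold sum_hat)
       (simp add: sum_distrib_left mult_ac)
  finally show ?thesis .
qed

lemma parseval:
  assumes "per h"
  shows "(\<Sum>x\<in>Zp. (norm (h x))\<^sup>2) = real p * (\<Sum>r\<in>Zp. (norm (hat h r))\<^sup>2)"
proof -
  have "complex_of_real (\<Sum>x\<in>Zp. (norm (h x))\<^sup>2)
      = complex_of_real (real p * (\<Sum>r\<in>Zp. (norm (hat h r))\<^sup>2))"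
    using plancherel[OF assms, of h]
    by (simp only: of_real_sum of_real_mult complex_norm_square of_real_of_nat_eq)
  then show ?thesis by (simp only: of_real_eq_iff)
qed

text \<open>Only \<open>h (x + y)\<close> is expanded; its characters split into a factor in
  \<open>x\<close> and one in \<open>y\<close>, so each double sum becomes a product of two
  transforms.\<close>

lemma schur_fourier:
  assumes "per h"
  shows "(\<Sum>x\<in>Zp. \<Sum>y\<in>Zp. h x * h y * cnj (h (x + y)))
    = (of_nat p)\<^sup>2 * (\<Sum>r\<in>Zp. (hat h r)\<^sup>2 * cnj (hat h r))"
proof -
  have "(\<Sum>x\<in>Zp. \<Sum>y\<in>Zp. h x * h y * cnj (h (x + y)))
      = (\<Sum>x\<in>Zp. \<Sum>y\<in>Zp. \<Sum>r\<in>Zp. 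
          cnj (hat h r) * ((h x * e (- (r * x))) * (h y * e (- (r * y)))))"
    by (subst fourier_inversion[OF assms, of "_ + _"])
       (simp add: sum_distrib_left mult_ac ring_distribs flip: e_add)
  also have "\<dots> = (\<Sum>x\<in>Zp. \<Sum>r\<in>Zp. \<Sum>y\<in>Zp. 
          cnj (hat h r) * ((h x * e (- (r * x))) * (h y * e (- (r * y)))))"
    by (intro sum.cong refl sum.swap)
  also have "\<dots> = (\<Sum>r\<in>Zp. \<Sum>x\<in>Zp. \<Sum>y\<in>Zp. 
          cnj (hat h r) * ((h x * e (- (r * x))) * (h y * e (- (r * y)))))"
    by (rule sum.swap)
  also have "\<dots> = (\<Sum>r\<in>Zp. cnj (hat h r) * ((\<Sum>x\<in>Zp. h x * e (- (r * x))) * (\<Sum>y\<in>Zp. h y * e (- (r * y)))))"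
    unfolding sum_product unfolding sum_distrib_left ..
  also have "\<dots> = (\<Sum>r\<in>Zp. cnj (hat h r) * ((of_nat p * hat h r) * (of_nat p * hat h r)))"
    using p_pos by (simp add: hat_def)
  also have "\<dots> = (of_nat p)\<^sup>2 * (\<Sum>r\<in>Zp. (hat h r)\<^sup>2 * cnj (hat h r))"
    by (simp add: sum_distrib_left power2_eq_square mult_ac)
  finally show ?thesis .
qed

lemma hat_convolution:
  assumes "per m"
  shows "hat (\<lambda>x. (\<Sum>y\<in>Zp. a y * m (x - y)) / of_nat p) r = hat a r * hat m r"
proof -
  have inner: "(\<Sum>x\<in>Zp. m (x - y) * e (- (r * (x - y)))) = of_nat p * hat m r" for y
    using sum_shift[OF per_mult[OF assms per_e[of "- r"]], of "- y"] p_pos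
    by (simp add: hat_def)
  have "(\<Sum>x\<in>Zp. (\<Sum>y\<in>Zp. a y * m (x - y)) / of_nat p * e (- (r * x)))
      = (\<Sum>x\<in>Zp. \<Sum>y\<in>Zp. a y * e (- (r * y)) * (m (x - y) * e (- (r * (x - y)))) / of_nat p)"
    unfolding sum_divide_distrib sum_distrib_right
    by (intro sum.cong refl) (simp add: algebra_simps flip: e_add)
  also have "\<dots> = (\<Sum>y\<in>Zp. a y * e (- (r * y)) * (\<Sum>x\<in>Zp. m (x - y) * e (- (r * (x - y)))) / of_nat p)"
    by (subst sum.swap) (simp add: sum_distrib_left sum_divide_distrib)
  also have "\<dots> = (\<Sum>y\<in>Zp. a y * e (- (r * y))) * hat m r"
    using p_pos by (simp add: inner sum_distrib_left mult_ac)
  finally show ?thesis by (simp add: hat_def)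
qed

lemma hat_mult:
  assumes "per h"
  shows "hat (\<lambda>x. h x * g x) r = (\<Sum>s\<in>Zp. hat h s * hat g (r - s))"
proof -
  have "(\<Sum>x\<in>Zp. h x * g x * e (- (r * x)))
      = (\<Sum>x\<in>Zp. \<Sum>s\<in>Zp. hat h s * (g x * e (- ((r - s) * x))))"
    by (subst fourier_inversion[OF assms])
       (simp add: sum_distrib_left sum_distrib_right algebra_simps flip: e_add)
  also have "\<dots> = (\<Sum>s\<in>Zp. hat h s * (\<Sum>x\<in>Zp. g x * e (- ((r - s) * x))))"
    by (subst sum.swap) (simp add: sum_distrib_left)
  also have "\<dots> = of_nat p * (\<Sum>s\<in>Zp. hat h s * hat g (r - s))"
    unfolding sum_hat by (simp add: sum_distrib_left mult_ac)
  finally show ?thesis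
    using p_pos by (simp add: hat_def[of "\<lambda>x. h x * g x"])
qed

lemma sum_reflect:
  fixes h :: "int \<Rightarrow> 'a :: comm_monoid_add"
  assumes "per h"
  shows "(\<Sum>x\<in>Zp. h (a - x)) = (\<Sum>x\<in>Zp. h x)"
proof (rule sum_reindex_mod[OF assms])
  show "inj_on (\<lambda>x. (a - x) mod int p) Zp"
  proof (rule inj_onI)
    fix x y assume "x \<in> Zp" "y \<in> Zp" "(a - x) mod int p = (a - y) mod int p"
    then show "x = y"
      by (metis atLeastLessThan_iff diff_diff_eq2 cancel_ab_semigroup_add_class.add_diff_cancel_left' mod_diff_right_eq mod_pos_pos_trivial)
  qed
qed

lemma hat_add: "hat (\<lambda>x. h x + g x) r = hat h r + hat g r"
  by (simp add: hat_def sum.distrib ring_distribs add_divide_distrib)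

lemma hat_cmult: "hat (\<lambda>x. c * h x) r = c * hat h r"
  by (simp add: hat_def sum_distrib_left mult_ac)

lemma hat_e: "hat (\<lambda>x. e (s * x)) r = (if int p dvd s - r then 1 else 0)"
proof -
  have "(\<Sum>x\<in>Zp. e (s * x) * e (- (r * x))) = (\<Sum>x\<in>Zp. e ((s - r) * x))"
    by (simp add: algebra_simps flip: e_add)
  then show ?thesis using p_pos by (simp add: hat_def sum_e)
qed

lemma hat_1: "hat (\<lambda>x. 1) r = (if int p dvd r then 1 else 0)"
  using hat_e[of 0 r] by simp

section \<open>The Wiener norm and positive definite functions\<close>

lemma wiener_1: "wiener (\<lambda>x. 1) = 1"
proof -
  have "wiener (\<lambda>x. 1) = (\<Sum>r\<in>Zp. if r = 0 then 1 else 0)"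
    unfolding wiener_def hat_1
    by (intro sum.cong refl) (auto simp: zdvd_not_zless dest: zdvd_imp_le)
  then show ?thesis using p_pos by simp
qed

lemma wiener_nonneg: "wiener h \<ge> 0"
  by (simp add: wiener_def sum_nonneg)

text \<open>By \<open>hat_mult\<close> the transform of a product is a convolution, and the l1 norm
  is submultiplicative under convolution.\<close>

lemma wiener_mult:
  assumes "per h"
  shows "wiener (\<lambda>x. h x * g x) \<le> wiener h * wiener g"
proof -
  have per: "per (\<lambda>r. norm (hat g r))"
    using per_hat[of g] by (simp add: per_def)
  have "wiener (\<lambda>x. h x * g x) \<le> (\<Sum>r\<in>Zp. \<Sum>s\<in>Zp. norm (hat h s) * norm (hat g (r - s)))"
    unfolding wiener_def hat_mult[OF assms]
    by (intro sum_mono order_trans[OF norm_sum]) (simp add: norm_mult)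
  also have "\<dots> = (\<Sum>s\<in>Zp. norm (hat h s) * (\<Sum>r\<in>Zp. norm (hat g (r - s))))"
    by (subst sum.swap) (simp add: sum_distrib_left)
  also have "\<dots> = wiener h * wiener g"
    using sum_shift[OF per, of "- _"] by (simp add: wiener_def sum_distrib_right)
  finally show ?thesis .
qed

lemma wiener_one_minus: "wiener (\<lambda>x. 1 - h x) \<le> 1 + wiener h"
proof -
  have "hat (\<lambda>x. 1 - h x) r = hat (\<lambda>x. 1) r - hat h r" for r
    by (simp add: hat_def sum_subtractf algebra_simps diff_divide_distrib)
  then have "wiener (\<lambda>x. 1 - h x) \<le> (\<Sum>r\<in>Zp. norm (hat (\<lambda>x. 1) r) + norm (hat h r))"
    unfolding wiener_def by (intro sum_mono) (simp add: norm_triangle_ineq4)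
  then show ?thesis
    using wiener_1 by (simp add: sum.distrib wiener_def)
qed

lemma wiener_power:
  assumes "per h"
  shows "wiener (\<lambda>x. h x ^ n) \<le> wiener h ^ n"
proof (induction n)
  case 0
  then show ?case by (simp add: wiener_1)
next
  case (Suc n)
  have "wiener (\<lambda>x. h x * h x ^ n) \<le> wiener h * wiener (\<lambda>x. h x ^ n)"
    by (rule wiener_mult[OF assms])
  also have "\<dots> \<le> wiener h * wiener h ^ n"
    by (intro mult_left_mono Suc wiener_nonneg)
  finally show ?case by simp
qed

lemma sum_nonneg_Reals: "(\<And>i. i \<in> I \<Longrightarrow> f i \<in> \<real>\<^sub>\<ge>\<^sub>0) \<Longrightarrow> sum f I \<in> \<real>\<^sub>\<ge>\<^sub>0"
  by (induction I rule: infinite_finite_induct) auto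

text \<open>A convolution of nonnegative sequences is nonnegative.\<close>

lemma posdef_mult:
  assumes "per h" "posdef h" "posdef g"
  shows "posdef (\<lambda>x. h x * g x)"
  using assms unfolding posdef_def hat_mult[OF assms(1)]
  by (auto intro!: nonneg_Reals_mult_I sum_nonneg_Reals)

end

subsection \<open>Pollard's theorem\<close>

locale prime_fourier =
  fixes p :: nat
  assumes prime_p: "prime p"

sublocale prime_fourier \<subseteq> cyclic_fourier
  by unfold_locales (use prime_p prime_gt_0_nat in auto)

context cyclic_fourier
begin

text \<open>For subsets of \<open>Zp\<close> this counts the ways to write \<open>x\<close> as a + b
  modulo \<open>p\<close>. Summing over \<open>B\<close> alone makes additivity in each set
  immediate; symmetry is recovered in \<open>rep_commute\<close>.\<close>

definition rep :: "int set \<Rightarrow> int set \<Rightarrow> int \<Rightarrow> nat" where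
  "rep A B x = (\<Sum>b\<in>B. of_bool ((x - b) mod int p \<in> A))"

lemma rep_le: "rep A B x \<le> card B"
proof -
  have "rep A B x \<le> (\<Sum>b\<in>B. 1)"
    unfolding rep_def by (rule sum_mono) auto
  then show ?thesis by simp
qed

lemma rep_Un_left: "A \<inter> A' = {} \<Longrightarrow> rep (A \<union> A') B x = rep A B x + rep A' B x"
  unfolding rep_def sum.distrib[symmetric] by (intro sum.cong refl) auto

lemma rep_Un_right:
  "finite B \<Longrightarrow> finite B' \<Longrightarrow> B \<inter> B' = {} \<Longrightarrow> rep A (B \<union> B') x = rep A B x + rep A B' x"
  unfolding rep_def by (rule sum.union_disjoint)

lemma rep_commute:
  assumes "A \<subseteq> Zp" "B \<subseteq> Zp"
  shows "rep A B x = rep B A x"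
proof -
  have "finite A" "finite B"
    using assms finite_subset[of _ Zp] by auto
  then have 1: "rep A B x = card {b \<in> B. (x - b) mod int p \<in> A}"
    and 2: "rep B A x = card {a \<in> A. (x - a) mod int p \<in> B}"
    by (simp_all add: rep_def Int_def)
  have inv: "(x - (x - b) mod int p) mod int p = b" if "b \<in> Zp" for b
    using that by (simp add: mod_diff_right_eq)
  have "bij_betw (\<lambda>b. (x - b) mod int p) {b \<in> B. (x - b) mod int p \<in> A}
      {a \<in> A. (x - a) mod int p \<in> B}"
    by (rule bij_betwI[where g = "\<lambda>b. (x - b) mod int p"])
       (use assms inv in \<open>auto simp: subset_iff\<close>)
  then show ?thesis
    unfolding 1 2 by (rule bij_betw_same_card)
qed

lemma sum_rep:
  assumes "A \<subseteq> Zp"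
  shows "(\<Sum>x\<in>Zp. rep A B x) = card A * card B"
proof -
  have per: "per (\<lambda>x. of_bool (x mod int p \<in> A) :: nat)"
    by (simp add: per_def)
  have "(\<Sum>x\<in>Zp. rep A B x) = (\<Sum>b\<in>B. \<Sum>x\<in>Zp. of_bool ((x - b) mod int p \<in> A))"
    unfolding rep_def by (rule sum.swap)
  also have "\<dots> = (\<Sum>b\<in>B. \<Sum>x\<in>Zp. of_bool (x mod int p \<in> A))"
    using sum_shift[OF per, of "- _"] by simp
  also have "(\<Sum>x\<in>Zp. of_bool (x mod int p \<in> A)) = (\<Sum>x\<in>Zp. of_bool (x \<in> A) :: nat)"
    by (intro sum.cong refl) simp
  also have "\<dots> = card A"
    using assms by (simp add: Int_absorb1)
  finally show ?thesis by simp
qed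

definition rot :: "int \<Rightarrow> int set \<Rightarrow> int set" where
  "rot d B = (\<lambda>b. (b + d) mod int p) ` B"

lemma inj_on_rot:
  assumes "B \<subseteq> Zp"
  shows "inj_on (\<lambda>b. (b + d) mod int p) B"
proof (rule inj_onI)
  fix x y assume "x \<in> B" "y \<in> B" "(x + d) mod int p = (y + d) mod int p"
  then show "x = y"
    using assms
    by (metis add_diff_cancel_right' atLeastLessThan_iff mod_diff_left_eq mod_pos_pos_trivial subsetD)
qed

text \<open>Translating \<open>B\<close> merely translates the representation function. This lets
  the induction in \<open>pollard\<close> replace \<open>B\<close> by a translate.\<close>

lemma sum_rep_rot:
  fixes F :: "nat \<Rightarrow> nat"
  assumes "B \<subseteq> Zp"
  shows "(\<Sum>x\<in>Zp. F (rep A (rot d B) x)) = (\<Sum>x\<in>Zp. F (rep A B x))"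
proof -
  have per: "per (\<lambda>x. F (rep A B x))"
    unfolding per_def rep_def by (simp add: mod_diff_left_eq)
  have "rep A (rot d B) x = rep A B (x - d)" for x
    unfolding rep_def rot_def
    by (simp add: sum.reindex[OF inj_on_rot[OF assms]] mod_diff_right_eq algebra_simps)
  then show ?thesis
    using sum_shift[OF per, of "- d"] by simp
qed

end

context prime_fourier
begin

text \<open>If no translate worked, \<open>A\<close> would be stable under a nonzero translation.\<close>

lemma exists_proper_rot:
  assumes "A \<subseteq> Zp" "A \<noteq> {}" "card A < p" and B: "B \<subseteq> Zp" "card B \<ge> 2"
  shows "\<exists>d. A \<inter> rot d B \<noteq> {} \<and> \<not> rot d B \<subseteq> A"
proof (rule ccontr)
  assume neg: "\<not> ?thesis"
  obtain b c where bc: "b \<in> B" "c \<in> B" "b \<noteq> c"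
    using B(2) by (metis One_nat_def Suc_1 card_le_Suc0_iff_eq card.infinite not_less_eq_eq zero_le)
  let ?h = "c - b"
  have step: "(a + ?h) mod int p \<in> A" if "a \<in> A" for a
  proof -
    have "a \<in> rot (a - b) B"
      using bc that assms(1) by (auto simp: rot_def intro!: image_eqI[of _ _ b])
    then have "rot (a - b) B \<subseteq> A"
      using neg that by blast
    moreover have "(a + ?h) mod int p \<in> rot (a - b) B"
      using bc by (auto simp: rot_def intro!: image_eqI[of _ _ c] arg_cong2[where f = "(mod)"])
    ultimately show ?thesis by blast
  qed
  obtain a where a: "a \<in> A" using assms by blast
  have iter: "(a + int n * ?h) mod int p \<in> A" for n
  proof (induction n)
    case 0
    then show ?case using a assms(1) by (auto simp: subset_iff)
  next
    case (Suc n)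
    have "((a + int n * ?h) mod int p + ?h) mod int p = (a + int (Suc n) * ?h) mod int p"
      by (subst mod_add_left_eq) (simp add: algebra_simps)
    with step[OF Suc] show ?case by simp
  qed
  have ndvd: "\<not> int p dvd ?h"
    using bc B(1) by (metis atLeastLessThan_iff mod_eq_dvd_iff mod_pos_pos_trivial subsetD)
  then have "coprime ?h (int p)"
    using prime_p by (metis prime_imp_coprime coprime_commute prime_int_nat_transfer prime_nat_int_transfer)
  then obtain k where k: "[?h * k = 1] (mod int p)"
    using cong_solve_coprime_int by blast
  have "Zp \<subseteq> A"
  proof
    fix x assume x: "x \<in> Zp"
    \<comment> \<open>The number of steps of length \<open>c - b\<close> from \<open>a\<close> to
      \<open>x\<close>, namely (x - a) / (c - b) modulo \<open>p\<close>.\<close>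
    define n where "n = nat ((k * (x - a)) mod int p)"
    have "int n = (k * (x - a)) mod int p"
      using p_pos by (simp add: n_def)
    then have "[a + int n * ?h = a + k * (x - a) * ?h] (mod int p)"
      by (intro cong_add cong_mult) (auto simp: cong_def)
    also have "[a + k * (x - a) * ?h = a + (?h * k) * (x - a)] (mod int p)"
      by (simp add: mult_ac)
    also have "[a + (?h * k) * (x - a) = a + 1 * (x - a)] (mod int p)"
      by (intro cong_add cong_mult k) auto
    finally have "(a + int n * ?h) mod int p = x"
      using x by (simp add: unique_euclidean_semiring_class.cong_def)
    then show "x \<in> A" using iter[of n] by simp
  qed
  then have "card Zp \<le> card A"
    using assms(1) by (metis card_mono finite_atLeastLessThan_int finite_subset)
  then show False using assms(3) by simp
qed

text \<open>Strong induction on \<open>card B\<close> by Dyson's transform. With I the intersection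
  of \<open>A\<close> and a translate of \<open>B\<close>, representations split into those of the
  pair (union, I) and those of the two set differences. If t is at most |I|, the first pair
  suffices; otherwise it is counted exactly, and the induction hypothesis is applied to the
  differences with t - |I|.\<close>

theorem pollard:
  assumes "A \<subseteq> Zp" "B \<subseteq> Zp" "t \<le> card A" "t \<le> card B" "card A + card B \<le> p + t"
  shows "t * (card A + card B) \<le> (\<Sum>x\<in>Zp. min t (rep A B x)) + t * t"
  using assms
proof (induction "card B" arbitrary: A B t rule: less_induct)
  case (less B0)
  show ?case
  proof (cases "t = 0 \<or> t = card B0")
    \<comment> \<open>For \<open>t = card B0\<close> the truncation has no effect, and the
      inequality is an equality by double counting.\<close>
    case True
    moreover have "(\<Sum>x\<in>Zp. min (card B0) (rep A B0 x)) = card A * card B0"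
      using sum_rep[OF less.prems(1), of B0] rep_le[of A B0] by (simp add: min_absorb2)
    ultimately show ?thesis by (auto simp: algebra_simps)
  next
    case False
    then have t: "1 \<le> t" "t < card B0" using less.prems by auto
    \<comment> \<open>From \<open>1 \<le> t < card B0\<close> follow \<open>card B0 \<ge> 2\<close>
      and, with the bound p + t on the sum of the cardinalities, \<open>card A < p\<close>.\<close>
    then obtain d where d: "A \<inter> rot d B0 \<noteq> {}" "\<not> rot d B0 \<subseteq> A"
      using exists_proper_rot[of A B0] less.prems by fastforce
    define B where "B = rot d B0"
    have BZ: "B \<subseteq> Zp" using p_pos by (auto simp: B_def rot_def)
    have cardB: "card B = card B0"
      unfolding B_def rot_def by (rule card_image[OF inj_on_rot[OF less.prems(2)]])
    have fin: "finite A" "finite B"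
      using BZ less.prems(1) finite_subset[of _ Zp] by auto
    define I A' B' where "I = A \<inter> B" and "A' = A - B" and "B' = B - A"
    have dec: "A = I \<union> A'" "I \<inter> A' = {}" "B = I \<union> B'" "I \<inter> B' = {}" "A \<inter> B' = {}"
      by (auto simp: I_def A'_def B'_def)
    have fin': "finite I" "finite A'" "finite B'"
      using fin by (auto simp: I_def A'_def B'_def)
    have sub: "I \<subseteq> Zp" "A' \<subseteq> Zp" "B' \<subseteq> Zp" "A \<union> B' \<subseteq> Zp"
      using BZ less.prems(1) by (auto simp: I_def A'_def B'_def)
    have cA: "card A = card I + card A'"
      using card_Un_disjoint[OF fin'(1,2) dec(2)] dec(1) by simp
    have cB: "card B = card I + card B'"
      using card_Un_disjoint[OF fin'(1,3) dec(4)] dec(3) by simp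
    have cU: "card (A \<union> B') = card A + card B'"
      by (rule card_Un_disjoint[OF fin(1) fin'(3) dec(5)])
    have I: "card I < card B0" "card I \<ge> 1"
    proof -
      have "B' \<noteq> {}" using d by (auto simp: B_def B'_def)
      then show "card I < card B0" using cB cardB fin' by (simp add: card_gt_0_iff)
      have "I \<noteq> {}" using d by (auto simp: I_def B_def)
      then show "card I \<ge> 1" using fin' by (simp add: Suc_le_eq card_gt_0_iff)
    qed
    have split: "rep A B x = rep (A \<union> B') I x + rep A' B' x" for x
    proof -
      have "rep A B x = rep A I x + rep A B' x"
        by (subst dec(3)) (rule rep_Un_right[OF fin'(1,3) dec(4)])
      also have "rep A B' x = rep B' A x"
        by (rule rep_commute) (use less.prems sub in auto)
      also have "rep B' A x = rep B' I x + rep B' A' x"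
        by (subst dec(1)) (rule rep_Un_right[OF fin'(1,2) dec(2)])
      also have "rep B' A' x = rep A' B' x"
        by (rule rep_commute) (use sub in auto)
      finally show ?thesis by (simp add: rep_Un_left[OF dec(5)])
    qed
    have goal: "t * (card A + card B) \<le> (\<Sum>x\<in>Zp. min t (rep A B x)) + t * t"
    proof (cases "t \<le> card I")
      case True
      have "t * (card (A \<union> B') + card I) \<le> (\<Sum>x\<in>Zp. min t (rep (A \<union> B') I x)) + t * t"
        by (rule less.hyps) (use I sub True cU cA cB cardB less.prems in auto)
      moreover have "(\<Sum>x\<in>Zp. min t (rep (A \<union> B') I x)) \<le> (\<Sum>x\<in>Zp. min t (rep A B x))"
        by (intro sum_mono) (simp add: split)
      moreover have "card (A \<union> B') + card I = card A + card B"
        using cU cB by simp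
      ultimately show ?thesis by simp
    next
      case False
      then obtain s where s: "t = card I + s" by (metis nat_le_linear le_Suc_ex)
      have "s * (card A' + card B') \<le> (\<Sum>x\<in>Zp. min s (rep A' B' x)) + s * s"
        by (rule less.hyps) (use I sub s cA cB cardB less.prems in auto)
      \<comment> \<open>The first summand never exceeds \<open>card I\<close>, so truncating the
        total at \<open>card I + s\<close> leaves room for at least \<open>s\<close> from the
        second.\<close>
      moreover have "(\<Sum>x\<in>Zp. rep (A \<union> B') I x + min s (rep A' B' x)) \<le> (\<Sum>x\<in>Zp. min t (rep A B x))"
      proof (rule sum_mono)
        fix x
        show "rep (A \<union> B') I x + min s (rep A' B' x) \<le> min t (rep A B x)"
          using rep_le[of "A \<union> B'" I x] by (simp add: split s min_def)
      qed
      then have "card (A \<union> B') * card I + (\<Sum>x\<in>Zp. min s (rep A' B' x)) \<le> (\<Sum>x\<in>Zp. min t (rep A B x))"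
        using sum_rep[OF sub(4), of I] by (simp add: sum.distrib)
      ultimately show ?thesis
        unfolding cU cA cB s by (simp add: algebra_simps)
    qed
    have "(\<Sum>x\<in>Zp. min t (rep A B x)) = (\<Sum>x\<in>Zp. min t (rep A B0 x))"
      unfolding B_def by (rule sum_rep_rot[OF less.prems(2)])
    with goal show ?thesis by (simp add: cardB)
  qed
qed

text \<open>Apply Pollard to m elements of \<open>B\<close>, paired with themselves;
  \<open>2 * m \<le> p\<close> makes it applicable. Of the guaranteed 2mt - t^2, the p - m residues
  outside the subset absorb at most t each; the rest counts pairs whose sum lies in the
  subset.\<close>

lemma schur_count_lower:
  assumes B: "B \<subseteq> Zp" and m: "m \<le> card B" "2 * m \<le> p" and t: "t \<le> m"
  shows "real t * (3 * real m - real p - real t)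
    \<le> (\<Sum>x\<in>Zp. \<Sum>y\<in>Zp. of_bool (x \<in> B \<and> y \<in> B \<and> (x + y) mod int p \<in> B))"
proof -
  obtain C where C: "C \<subseteq> B" "card C = m" "finite C"
    using obtain_subset_with_card_n[OF m(1)] by metis
  have CZ: "C \<subseteq> Zp" using C B by blast
  \<comment> \<open>The reduction of \<open>x\<close> changes nothing on \<open>Zp\<close> but makes
    the function periodic, so that \<open>sum_shift\<close> can later replace \<open>x\<close> by
    \<open>x + y\<close>.\<close>
  let ?f = "\<lambda>x y. of_bool (x mod int p \<in> C \<and> y \<in> C \<and> (x - y) mod int p \<in> C) :: nat"
  have "t * (card C + card C) \<le> (\<Sum>x\<in>Zp. min t (rep C C x)) + t * t"
    by (rule pollard) (use C CZ m t in auto)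
  also have "(\<Sum>x\<in>Zp. min t (rep C C x)) = (\<Sum>x\<in>Zp - C. min t (rep C C x)) + (\<Sum>x\<in>C. min t (rep C C x))"
    by (rule sum.subset_diff[OF CZ]) simp
  also have "\<dots> \<le> (\<Sum>x\<in>Zp - C. t) + (\<Sum>x\<in>C. rep C C x)"
    by (intro add_mono sum_mono) auto
  also have "(\<Sum>x\<in>Zp - C. t) = (p - m) * t"
    using C CZ by (simp add: card_Diff_subset)
  also have "(\<Sum>x\<in>C. rep C C x) = (\<Sum>x\<in>Zp. \<Sum>y\<in>Zp. ?f x y)"
    unfolding rep_def
    by (intro sum.mono_neutral_cong_left CZ sum.mono_neutral_cong_left) (use CZ in auto)
  also have "\<dots> = (\<Sum>y\<in>Zp. \<Sum>x\<in>Zp. ?f x y)"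
    by (rule sum.swap)
  also have "\<dots> = (\<Sum>y\<in>Zp. \<Sum>x\<in>Zp. ?f (x + y) y)"
    by (intro sum.cong refl sum_shift[symmetric]) (simp add: per_def mod_diff_left_eq)
  also have "\<dots> \<le> (\<Sum>y\<in>Zp. \<Sum>x\<in>Zp. of_bool (y \<in> B \<and> x \<in> B \<and> (y + x) mod int p \<in> B))"
    by (intro sum_mono) (use C(1) in \<open>auto simp: add.commute\<close>)
  finally have *: "real (t * (m + m))
      \<le> real ((p - m) * t + (\<Sum>y\<in>Zp. \<Sum>x\<in>Zp. of_bool (y \<in> B \<and> x \<in> B \<and> (y + x) mod int p \<in> B)) + t * t)"
    unfolding of_nat_le_iff using C(2) by simp
  have "real (p - m) = real p - real m" using m by simp
  with * show ?thesis
    unfolding of_nat_add of_nat_mult of_nat_sum of_nat_of_bool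
    by (simp only: algebra_simps)
qed

end

subsection \<open>Kloosterman sums\<close>

context prime_fourier
begin

abbreviation Zpx :: "int set" where "Zpx \<equiv> {1..<int p}"

text \<open>The inverse of the ring itself, so that \<open>inverse_set\<close> unfolds to it. Its
  value at 0 is unspecified, hence the sums over \<open>Zpx\<close>.\<close>

definition minv :: "int \<Rightarrow> int" where
  "minv x = inv\<^bsub>prime_field p\<^esub> x"

lemma minv:
  assumes "x \<in> Zpx"
  shows "minv x \<in> Zpx" and "(x * minv x) mod int p = 1"
proof -
  interpret residues_prime p "prime_field p"
    by unfold_locales (use prime_p in simp_all)
  have x: "x \<in> Units (prime_field p)"
    using assms by (simp add: res_prime_units_eq)
  show "minv x \<in> Zpx"
    using Units_inv_Units[OF x] unfolding minv_def res_prime_units_eq by auto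
  show "(x * minv x) mod int p = 1"
    using Units_r_inv[OF x] by (simp add: minv_def res_mult_eq res_one_eq)
qed

lemma prime_int_p: "prime (int p)"
  using prime_p by simp

lemma not_dvd_unit: "x \<in> Zpx \<Longrightarrow> \<not> int p dvd x"
  using zdvd_imp_le[of "int p" x] by auto

lemma cong_imp_eq:
  assumes "int p dvd x - y" "x \<in> Zp" "y \<in> Zp"
  shows "x = y"
  using assms by (metis atLeastLessThan_iff mod_eq_dvd_iff mod_pos_pos_trivial)

lemma dvd_minv: "x \<in> Zpx \<Longrightarrow> int p dvd x * minv x - 1"
  using minv(2)[of x] prime_gt_1_int[OF prime_int_p]
  by (metis mod_eq_dvd_iff mod_pos_pos_trivial zero_le_one)

lemma minv_unique:
  assumes "x \<in> Zpx" "y \<in> Zpx" "int p dvd x * y - 1"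
  shows "minv x = y"
proof -
  have "int p dvd (x * minv x - 1) - (x * y - 1)"
    using dvd_minv[OF assms(1)] assms(3) by (rule dvd_diff)
  then have "int p dvd x * (minv x - y)" by (simp add: algebra_simps)
  then have "int p dvd minv x - y"
    using prime_int_p not_dvd_unit[OF assms(1)] by (simp add: prime_dvd_mult_iff)
  then show ?thesis
    using minv(1)[OF assms(1)] assms(2) by (intro cong_imp_eq) auto
qed

lemma minv_minv: "x \<in> Zpx \<Longrightarrow> minv (minv x) = x"
  by (rule minv_unique) (auto simp: minv(1)[simplified] mult.commute dvd_minv)

lemma mult_mod_unit: "t \<in> Zpx \<Longrightarrow> x \<in> Zpx \<Longrightarrow> (t * x) mod int p \<in> Zpx"
proof -
  assume "t \<in> Zpx" "x \<in> Zpx"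
  then have "\<not> int p dvd t * x"
    using not_dvd_unit prime_int_p by (simp add: prime_dvd_mult_iff)
  then have "(t * x) mod int p \<noteq> 0" by (simp add: dvd_eq_mod_eq_0)
  moreover have "0 \<le> (t * x) mod int p" "(t * x) mod int p < int p"
    using p_pos by auto
  ultimately show ?thesis by auto
qed

lemma minv_mult:
  assumes "t \<in> Zpx" "x \<in> Zpx"
  shows "minv ((t * x) mod int p) = (minv t * minv x) mod int p"
proof (rule minv_unique)
  have "int p dvd (t * minv t - 1) * (x * minv x) + (x * minv x - 1)"
    using dvd_minv[OF assms(1)] dvd_minv[OF assms(2)] by simp
  then have "int p dvd (t * x) * (minv t * minv x) - 1"
    by (simp add: algebra_simps)
  then show "int p dvd (t * x) mod int p * ((minv t * minv x) mod int p) - 1"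
    by (metis mod_eq_dvd_iff mod_mult_eq)
qed (use assms mult_mod_unit minv in auto)

lemma bij_mult_unit:
  assumes "t \<in> Zpx"
  shows "bij_betw (\<lambda>x. (t * x) mod int p) Zpx Zpx"
proof -
  have inj: "inj_on (\<lambda>x. (t * x) mod int p) Zpx"
  proof (rule inj_onI)
    fix x y assume xy: "x \<in> Zpx" "y \<in> Zpx" "(t * x) mod int p = (t * y) mod int p"
    then have "int p dvd t * (x - y)"
      by (simp add: mod_eq_dvd_iff right_diff_distrib)
    then have "int p dvd x - y"
      using prime_int_p not_dvd_unit[OF assms] by (simp add: prime_dvd_mult_iff)
    then show "x = y" using xy by (intro cong_imp_eq) auto
  qed
  moreover have "(\<lambda>x. (t * x) mod int p) ` Zpx = Zpx"
    by (rule endo_inj_surj) (use inj mult_mod_unit[OF assms] in auto)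
  ultimately show ?thesis by (simp add: bij_betw_def)
qed

section \<open>Kloosterman sums and their fourth moment\<close>

definition kloosterman :: "int \<Rightarrow> int \<Rightarrow> complex" where
  "kloosterman r s = (\<Sum>x\<in>Zpx. e (r * x + s * minv x))"

text \<open>Multiplication by \<open>t\<close> permutes the nonzero residues and multiplies inverses
  by \<open>minv t\<close>.\<close>

lemma kloosterman_scale:
  assumes "t \<in> Zpx"
  shows "kloosterman ((r * t) mod int p) ((s * minv t) mod int p) = kloosterman r s"
proof -
  have "kloosterman r s = (\<Sum>x\<in>Zpx. e (r * ((t * x) mod int p) + s * minv ((t * x) mod int p)))"
    unfolding kloosterman_def by (rule sum.reindex_bij_betw[OF bij_mult_unit[OF assms], symmetric])
  also have "\<dots> = kloosterman ((r * t) mod int p) ((s * minv t) mod int p)"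
    unfolding kloosterman_def
  proof (intro sum.cong refl e_cong)
    fix x assume x: "x \<in> Zpx"
    show "(r * ((t * x) mod int p) + s * minv ((t * x) mod int p)) mod int p
        = ((r * t) mod int p * x + (s * minv t) mod int p * minv x) mod int p"
      unfolding minv_mult[OF assms x]
      by (intro mod_add_cong) (metis mod_mult_left_eq mod_mult_right_eq mult.assoc)+
  qed
  finally show ?thesis by simp
qed

definition quadruples :: "(int \<times> int \<times> int \<times> int) set" where
  "quadruples = {(w, x, y, z). w \<in> Zpx \<and> x \<in> Zpx \<and> y \<in> Zpx \<and> z \<in> Zpx \<and>
     int p dvd w + x - y - z \<and> int p dvd minv w + minv x - minv y - minv z}"

text \<open>Clearing denominators and using w + x = y + z turns the second congruence into (w +
  x)(yz - wx) = 0. If w + x = 0, then also y + z = 0; otherwise the pairs {w, x} and {y, z} have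
  equal sum and product and hence coincide.\<close>

lemma quadruples_cases:
  assumes "(w, x, y, z) \<in> quadruples"
  shows "(y = w \<and> z = x) \<or> (y = x \<and> z = w) \<or> (x = int p - w \<and> z = int p - y)"
proof -
  have U: "w \<in> Zpx" "x \<in> Zpx" "y \<in> Zpx" "z \<in> Zpx"
    and d1: "int p dvd w + x - y - z"
    and d2: "int p dvd minv w + minv x - minv y - minv z"
    using assms by (auto simp: quadruples_def)
  \<comment> \<open>The second congruence times wxyz, corrected by multiples of
    \<open>w * minv w - 1\<close> and its analogues to cancel each inverse, and by the first
    congruence to replace y + z by w + x.\<close>
  have "int p dvd (minv w + minv x - minv y - minv z) * (w * x * y * z)
      - (w * minv w - 1) * (x * y * z) - (x * minv x - 1) * (w * y * z)
      + (y * minv y - 1) * (w * x * z) + (z * minv z - 1) * (w * x * y)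
      - (w + x - y - z) * (w * x)"
    by (rule dvd_diff[OF dvd_add[OF dvd_add[OF dvd_diff[OF dvd_diff]]]]; rule dvd_mult2)
       (rule d1 d2 dvd_minv U)+
  also have "\<dots> = (w + x) * (y * z - w * x)"
    by (simp add: algebra_simps)
  finally have "int p dvd w + x \<or> int p dvd y * z - w * x"
    using prime_int_p by (simp add: prime_dvd_mult_iff)
  then show ?thesis
  proof
    assume wx: "int p dvd w + x"
    have "int p dvd (w + x) - (w + x - y - z)"
      using wx d1 by (rule dvd_diff)
    then have yz: "int p dvd y + z" by simp
    have "int p dvd x - (int p - w)" "int p dvd z - (int p - y)"
      using wx yz by (simp_all add: algebra_simps)
    then have "x = int p - w" "z = int p - y"
      using U by (simp_all add: cong_imp_eq)
    then show ?thesis by simp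
  next
    assume "int p dvd y * z - w * x"
    then have "int p dvd - (y * z - w * x) - (w + x - y - z) * y"
      by (intro dvd_diff dvd_mult2[OF d1]) (simp_all only: dvd_minus_iff)
    also have "- (y * z - w * x) - (w + x - y - z) * y = (y - w) * (y - x)"
      by (simp add: algebra_simps)
    finally have "int p dvd y - w \<or> int p dvd y - x"
      using prime_int_p by (simp add: prime_dvd_mult_iff)
    then have "y = w \<or> y = x"
      using U by (elim disjE) (auto dest: cong_imp_eq)
    then show ?thesis
    proof
      assume "y = w"
      then have "x = z" using d1 U by (intro cong_imp_eq) auto
      with \<open>y = w\<close> show ?thesis by simp
    next
      assume "y = x"
      then have "w = z" using d1 U by (intro cong_imp_eq) auto
      with \<open>y = x\<close> show ?thesis by simp
    qed
  qed
qed

lemma nat_p_minus_1: "nat (int p - 1) = p - 1"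
  by linarith

lemma card_quadruples: "card quadruples \<le> 3 * (p - 1)\<^sup>2"
proof -
  let ?U = "Zpx \<times> Zpx"
  let ?N1 = "(\<lambda>(w, x). (w, x, w, x)) ` ?U" and ?N2 = "(\<lambda>(w, x). (w, x, x, w)) ` ?U"
    and ?N3 = "(\<lambda>(w, y). (w, int p - w, y, int p - y)) ` ?U"
  have "quadruples \<subseteq> ?N1 \<union> ?N2 \<union> ?N3"
  proof
    fix q assume q: "q \<in> quadruples"
    obtain w x y z where q_eq: "q = (w, x, y, z)" by (cases q)
    then have wxy: "(w, x) \<in> ?U" "(w, y) \<in> ?U"
      using q by (auto simp: quadruples_def)
    from quadruples_cases[OF q[unfolded q_eq]]
    show "q \<in> ?N1 \<union> ?N2 \<union> ?N3"
    proof (elim disjE conjE)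
      assume "y = w" "z = x"
      then have "q \<in> ?N1" using wxy(1) q_eq by (intro image_eqI[of _ _ "(w, x)"]) auto
      then show ?thesis by blast
    next
      assume "y = x" "z = w"
      then have "q \<in> ?N2" using wxy(1) q_eq by (intro image_eqI[of _ _ "(w, x)"]) auto
      then show ?thesis by blast
    next
      assume "x = int p - w" "z = int p - y"
      then have "q \<in> ?N3" using wxy(2) q_eq by (intro image_eqI[of _ _ "(w, y)"]) auto
      then show ?thesis by blast
    qed
  qed
  then have "card quadruples \<le> card (?N1 \<union> ?N2 \<union> ?N3)"
    by (rule card_mono[rotated]) auto
  also have "\<dots> \<le> card ?N1 + card ?N2 + card ?N3"
    by (rule order_trans[OF card_Un_le]) (intro add_mono card_Un_le order_refl)
  also have "\<dots> \<le> card ?U + card ?U + card ?U"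
    by (intro add_mono card_image_le) auto
  also have "card ?U = (p - 1)\<^sup>2"
    by (simp add: power2_eq_square nat_p_minus_1)
  finally show ?thesis by simp
qed

text \<open>Expanding K K cnj(K) cnj(K) gives one character in a and one in b for each quadruple of
  units. Orthogonality in each variable forces one congruence of \<open>quadruples\<close> and
  contributes a factor p.\<close>

lemma kloosterman_fourth_moment:
  "(\<Sum>a\<in>Zp. \<Sum>b\<in>Zp. norm (kloosterman a b) ^ 4) = real (p\<^sup>2 * card quadruples)"
proof -
  let ?Q = "Zpx \<times> Zpx \<times> Zpx \<times> Zpx"
  define u where "u = (\<lambda>(w, x, y, z). w + x - y - z :: int)"
  define v where "v = (\<lambda>(w, x, y, z). minv w + minv x - minv y - minv z)"
  have K: "complex_of_real (norm (kloosterman a b) ^ 4) = (\<Sum>q\<in>?Q. e (u q * a) * e (v q * b))" for a b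
  proof -
    have "complex_of_real (norm (kloosterman a b) ^ 4) = ((kloosterman a b) * cnj (kloosterman a b))\<^sup>2"
      unfolding complex_norm_square[symmetric] of_real_power[symmetric] by (simp flip: power_mult)
    also have "\<dots> = kloosterman a b * (kloosterman a b * (cnj (kloosterman a b) * cnj (kloosterman a b)))"
      by (simp add: power2_eq_square mult_ac)
    also have "\<dots> = (\<Sum>w\<in>Zpx. \<Sum>x\<in>Zpx. \<Sum>y\<in>Zpx. \<Sum>z\<in>Zpx.
        e (a * w + b * minv w) * (e (a * x + b * minv x) *
          (e (- (a * y + b * minv y)) * e (- (a * z + b * minv z)))))"
      unfolding kloosterman_def cnj_sum cnj_e unfolding sum_product unfolding sum_distrib_left ..
    also have "\<dots> = (\<Sum>q\<in>?Q. e (u q * a) * e (v q * b))"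
      unfolding sum.cartesian_product
      unfolding e_add[symmetric] u_def v_def
      by (intro sum.cong refl) (simp add: split_beta algebra_simps)
    finally show ?thesis .
  qed
  have "complex_of_real (\<Sum>a\<in>Zp. \<Sum>b\<in>Zp. norm (kloosterman a b) ^ 4)
      = (\<Sum>a\<in>Zp. \<Sum>b\<in>Zp. \<Sum>q\<in>?Q. e (u q * a) * e (v q * b))"
    by (simp only: of_real_sum K)
  also have "\<dots> = (\<Sum>a\<in>Zp. \<Sum>q\<in>?Q. \<Sum>b\<in>Zp. e (u q * a) * e (v q * b))"
    by (intro sum.cong refl sum.swap)
  also have "\<dots> = (\<Sum>q\<in>?Q. \<Sum>a\<in>Zp. \<Sum>b\<in>Zp. e (u q * a) * e (v q * b))"
    by (rule sum.swap)
  also have "\<dots> = (\<Sum>q\<in>?Q. (\<Sum>a\<in>Zp. e (u q * a)) * (\<Sum>b\<in>Zp. e (v q * b)))"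
    by (simp only: sum_product)
  also have "\<dots> = (\<Sum>q\<in>?Q. if q \<in> quadruples then of_nat (p\<^sup>2) else 0)"
    unfolding sum_e
    by (intro sum.cong refl) (auto simp: quadruples_def u_def v_def power2_eq_square)
  also have "\<dots> = (\<Sum>q\<in>quadruples. of_nat (p\<^sup>2))"
    by (intro sum.mono_neutral_cong_right) (auto simp: quadruples_def)
  also have "\<dots> = complex_of_real (real (p\<^sup>2 * card quadruples))"
    by simp
  finally show ?thesis by (simp only: of_real_eq_iff)
qed

text \<open>The orbit of \<open>(r, s)\<close> under \<open>kloosterman_scale\<close> has \<open>p - 1\<close> elements, all with the same Kloosterman
  sum, so a single one is bounded through the fourth moment.\<close>

lemma kloosterman_bound:
  assumes "r \<in> Zp" "s \<in> Zp" "(r, s) \<noteq> (0, 0)"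
  shows "norm (kloosterman r s) ^ 4 \<le> 3 * real p ^ 3"
proof -
  let ?o = "\<lambda>t. ((r * t) mod int p, (s * minv t) mod int p)"
  have canc: "x = y" if c: "c \<in> Zp" "c \<noteq> 0" and xy: "x \<in> Zpx" "y \<in> Zpx"
    and eq: "(c * x) mod int p = (c * y) mod int p" for c x y
  proof -
    have "c \<in> Zpx" using c by simp
    from inj_onD[OF bij_betw_imp_inj_on[OF bij_mult_unit[OF this]] eq xy] show ?thesis .
  qed
  \<comment> \<open>One of \<open>r\<close>, \<open>s\<close> is nonzero, and the corresponding
    coordinate already determines the parameter.\<close>
  have inj: "inj_on ?o Zpx"
  proof (rule inj_onI)
    fix x y assume xy: "x \<in> Zpx" "y \<in> Zpx" and eq: "?o x = ?o y"
    show "x = y"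
    proof (cases "r = 0")
      case False
      show ?thesis by (rule canc[OF assms(1) False xy conjunct1[OF eq[unfolded prod.inject]]])
    next
      case True
      then have "s \<noteq> 0" using assms(3) by blast
      from canc[OF assms(2) this minv(1)[OF xy(1)] minv(1)[OF xy(2)] conjunct2[OF eq[unfolded prod.inject]]]
      have "minv (minv x) = minv (minv y)" by (rule arg_cong)
      then show ?thesis unfolding minv_minv[OF xy(1)] minv_minv[OF xy(2)] .
    qed
  qed
  have "real (p - 1) * norm (kloosterman r s) ^ 4 = (\<Sum>t\<in>Zpx. norm (kloosterman r s) ^ 4)"
    by (simp add: nat_p_minus_1)
  also have "\<dots> = (\<Sum>t\<in>Zpx. (\<lambda>(a, b). norm (kloosterman a b) ^ 4) (?o t))"
    by (intro sum.cong refl) (simp only: prod.case kloosterman_scale)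
  also have "\<dots> = (\<Sum>c\<in>?o ` Zpx. (\<lambda>(a, b). norm (kloosterman a b) ^ 4) c)"
    unfolding sum.reindex[OF inj] comp_def ..
  also have "\<dots> \<le> (\<Sum>c\<in>Zp \<times> Zp. (\<lambda>(a, b). norm (kloosterman a b) ^ 4) c)"
    using p_pos by (intro sum_mono2) auto
  also have "\<dots> = real (p\<^sup>2 * card quadruples)"
    unfolding sum.cartesian_product[symmetric] by (rule kloosterman_fourth_moment)
  also have "\<dots> \<le> real (p\<^sup>2 * (3 * (p - 1)\<^sup>2))"
    unfolding of_nat_le_iff by (intro mult_left_mono card_quadruples) auto
  also have "\<dots> = real (p - 1) * (3 * real p ^ 2 * real (p - 1))"
    by (simp only: power2_eq_square of_nat_mult of_nat_numeral mult_ac)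
  \<comment> \<open>The size \<open>p - 1\<close> of the orbit cancels one of the two factors
    \<open>p - 1\<close> in \<open>card_quadruples\<close>.\<close>
  finally have "norm (kloosterman r s) ^ 4 \<le> 3 * real p ^ 2 * real (p - 1)"
    by (rule mult_left_le_imp_le) (use prime_gt_1_nat[OF prime_p] in simp)
  also have "\<dots> \<le> 3 * real p ^ 2 * real p"
    by (intro mult_left_mono) auto
  finally show ?thesis by (simp add: power3_eq_cube power2_eq_square)
qed

text \<open>Expanding both factors gives the sum of
  \<open>hat g r * hat g s * kloosterman r s\<close>. Frequency (0, 0) is the main term; the others
  share a uniform bound, and the coefficients sum to the squared Wiener norm.\<close>

lemma inverse_equidistribution:
  assumes "per g"
  shows "norm ((\<Sum>x\<in>Zpx. g x * g (minv x)) - of_nat (p - 1) * (hat g 0)\<^sup>2)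
    \<le> root 4 (3 * real p ^ 3) * (wiener g)\<^sup>2"
proof -
  let ?\<kappa> = "root 4 (3 * real p ^ 3)"
  define E where "E r s = kloosterman r s - (if r = 0 \<and> s = 0 then of_nat (p - 1) else 0)" for r s
  have E: "norm (E r s) \<le> ?\<kappa>" if "r \<in> Zp" "s \<in> Zp" for r s
  proof (cases "r = 0 \<and> s = 0")
    case True
    then show ?thesis by (simp add: E_def kloosterman_def nat_p_minus_1)
  next
    case False
    then have "norm (E r s) ^ 4 \<le> 3 * real p ^ 3"
      using kloosterman_bound[OF that] by (auto simp: E_def)
    then have "root 4 (norm (E r s) ^ 4) \<le> ?\<kappa>"
      by simp
    then show ?thesis by (simp add: real_root_power_cancel)
  qed
  have "(\<Sum>x\<in>Zpx. g x * g (minv x))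
      = (\<Sum>x\<in>Zpx. \<Sum>r\<in>Zp. \<Sum>s\<in>Zp. hat g r * hat g s * e (r * x + s * minv x))"
    by (subst fourier_inversion[OF assms], subst fourier_inversion[OF assms])
       (simp add: sum_product e_add mult_ac)
  also have "\<dots> = (\<Sum>r\<in>Zp. \<Sum>x\<in>Zpx. \<Sum>s\<in>Zp. hat g r * hat g s * e (r * x + s * minv x))"
    by (rule sum.swap)
  also have "\<dots> = (\<Sum>r\<in>Zp. \<Sum>s\<in>Zp. \<Sum>x\<in>Zpx. hat g r * hat g s * e (r * x + s * minv x))"
    by (intro sum.cong refl sum.swap)
  also have "\<dots> = (\<Sum>r\<in>Zp. \<Sum>s\<in>Zp. hat g r * hat g s * kloosterman r s)"
    by (simp add: kloosterman_def sum_distrib_left)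
  also have "\<dots> = (\<Sum>r\<in>Zp. \<Sum>s\<in>Zp. hat g r * hat g s * E r s
      + (if s = 0 then if r = 0 then of_nat (p - 1) * (hat g 0)\<^sup>2 else 0 else 0))"
    by (intro sum.cong refl) (auto simp: E_def algebra_simps power2_eq_square)
  also have "\<dots> = (\<Sum>r\<in>Zp. \<Sum>s\<in>Zp. hat g r * hat g s * E r s) + of_nat (p - 1) * (hat g 0)\<^sup>2"
    using p_pos by (simp add: sum.distrib)
  finally have "norm ((\<Sum>x\<in>Zpx. g x * g (minv x)) - of_nat (p - 1) * (hat g 0)\<^sup>2)
      = norm (\<Sum>r\<in>Zp. \<Sum>s\<in>Zp. hat g r * hat g s * E r s)"
    by simp
  also have "\<dots> \<le> (\<Sum>r\<in>Zp. \<Sum>s\<in>Zp. norm (hat g r) * norm (hat g s) * ?\<kappa>)"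
    by (intro order_trans[OF norm_sum] sum_mono) (auto simp: norm_mult intro!: mult_left_mono E)
  also have "\<dots> = ?\<kappa> * (wiener g)\<^sup>2"
    by (simp add: wiener_def power2_eq_square sum_product sum_distrib_left mult_ac)
  finally show ?thesis .
qed

end

subsection \<open>Positive definite kernels\<close>

context cyclic_fourier
begin

abbreviation cx :: "(int \<Rightarrow> real) \<Rightarrow> int \<Rightarrow> complex" where
  "cx f \<equiv> \<lambda>x. complex_of_real (f x)"

definition mean :: "(int \<Rightarrow> real) \<Rightarrow> real" where
  "mean f = (\<Sum>x\<in>Zp. f x) / real p"

lemma hat_cx_0: "hat (cx f) 0 = complex_of_real (mean f)"
  by (simp add: hat_0 mean_def)

lemma per_cx: "per f \<Longrightarrow> per (cx f)"
  by (simp add: per_def)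

lemma mean_mono: "(\<And>x. f x \<le> g x) \<Longrightarrow> mean f \<le> mean g"
  unfolding mean_def by (intro divide_right_mono sum_mono) auto

lemma mean_cmult: "mean (\<lambda>x. c * f x) = c * mean f"
  by (simp add: mean_def flip: sum_distrib_left)

lemma mean_diff: "mean (\<lambda>x. f x - g x) = mean f - mean g"
  by (simp add: mean_def sum_subtractf diff_divide_distrib)

lemma norm_hat_le: "norm (hat h r) \<le> mean (\<lambda>x. norm (h x))"
proof -
  have "norm (\<Sum>x\<in>Zp. h x * e (- (r * x))) \<le> (\<Sum>x\<in>Zp. norm (h x))"
    by (rule order_trans[OF norm_sum]) (simp add: norm_mult)
  then show ?thesis
    by (simp add: hat_def mean_def norm_divide divide_right_mono)
qed

lemma posdef_e: "posdef (\<lambda>x. e (s * x))"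
  by (simp add: posdef_def hat_e)

lemma posdef_1: "posdef (\<lambda>x. 1)"
  by (simp add: posdef_def hat_1)

lemma posdef_add: "posdef h \<Longrightarrow> posdef g \<Longrightarrow> posdef (\<lambda>x. h x + g x)"
  by (simp add: posdef_def hat_add)

lemma posdef_cmult: "c \<ge> 0 \<Longrightarrow> posdef h \<Longrightarrow> posdef (\<lambda>x. complex_of_real c * h x)"
  by (simp add: posdef_def hat_cmult)

lemma per_power: "per h \<Longrightarrow> per (\<lambda>x. h x ^ n)"
  by (simp add: per_def)

lemma per_prod: "(\<And>i. i \<in> I \<Longrightarrow> per (h i)) \<Longrightarrow> per (\<lambda>x. \<Prod>i\<in>I. h i x)"
  by (simp add: per_def)

lemma posdef_power: "per h \<Longrightarrow> posdef h \<Longrightarrow> posdef (\<lambda>x. h x ^ n)"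
  by (induction n) (auto intro: posdef_1 posdef_mult)

lemma posdef_prod:
  "(\<And>i. i \<in> I \<Longrightarrow> per (h i)) \<Longrightarrow> (\<And>i. i \<in> I \<Longrightarrow> posdef (h i)) \<Longrightarrow> posdef (\<lambda>x. \<Prod>i\<in>I. h i x)"
  by (induction I rule: infinite_finite_induct) (auto intro: posdef_1 posdef_mult)

text \<open>The mean of the product is a sum over \<open>s\<close> of nonnegative terms, and the
  term for \<open>s = 0\<close> is the left-hand side.\<close>

lemma mean_mult_posdef:
  assumes "per f" "posdef (cx f)" "posdef (cx g)"
  shows "mean f * mean g \<le> mean (\<lambda>x. f x * g x)"
proof -
  have nn: "Re (hat (cx f) s * hat (cx g) (0 - s)) \<ge> 0" for s
  proof -
    have "hat (cx f) s * hat (cx g) (0 - s) \<in> \<real>\<^sub>\<ge>\<^sub>0"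
      using assms by (intro nonneg_Reals_mult_I) (auto simp: posdef_def)
    then show ?thesis by (simp only: complex_nonneg_Reals_iff)
  qed
  have "mean f * mean g = Re (hat (cx f) 0 * hat (cx g) (0 - 0))"
    by (simp add: hat_cx_0)
  also have "\<dots> \<le> (\<Sum>s\<in>Zp. Re (hat (cx f) s * hat (cx g) (0 - s)))"
    using p_pos by (intro member_le_sum nn) auto
  also have "\<dots> = Re (hat (\<lambda>x. cx f x * cx g x) 0)"
    by (simp only: hat_mult[OF per_cx[OF assms(1)]] Re_sum)
  also have "\<dots> = mean (\<lambda>x. f x * g x)"
    using hat_cx_0[of "\<lambda>x. f x * g x"] by simp
  finally show ?thesis .
qed

text \<open>This is cos^2(pi s x / p): between 0 and 1, equal to 1 at 0, with nonnegative
  coefficients. High powers concentrate where s x / p is near an integer.\<close>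

definition cos_weight :: "int \<Rightarrow> int \<Rightarrow> real" where
  "cos_weight s x = (1 + Re (e (s * x))) / 2"

lemma cos_weight_bounds: "0 \<le> cos_weight s x" "cos_weight s x \<le> 1"
  using abs_Re_le_cmod[of "e (s * x)"] by (auto simp: cos_weight_def)

lemma cos_weight_0 [simp]: "cos_weight s 0 = 1"
  by (simp add: cos_weight_def)

lemma per_cos_weight: "per (cos_weight s)"
  using per_e[of s] by (simp add: per_def cos_weight_def)

lemma posdef_cos_weight: "posdef (cx (cos_weight s))"
proof -
  have "cx (cos_weight s) = (\<lambda>x. complex_of_real (1/2) * 1 + (complex_of_real (1/4) * e (s * x)
      + complex_of_real (1/4) * e (- s * x)))"
  proof
    fix x
    have "Re (e (- s * x)) = Re (e (s * x))" "Im (e (- s * x)) = - Im (e (s * x))"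
      by (simp_all add: e_def)
    then show "complex_of_real (cos_weight s x) = complex_of_real (1/2) * 1 + (complex_of_real (1/4) * e (s * x)
      + complex_of_real (1/4) * e (- s * x))"
      by (simp only: cos_weight_def complex_eq_iff) (simp add: field_simps)
  qed
  then show ?thesis
    by (simp only:) (intro posdef_add posdef_cmult posdef_1 posdef_e; simp)
qed

lemma cos_weight_eq_norm: "cos_weight s x = (norm ((1 + e (s * x)) / 2))\<^sup>2"
proof -
  have "(Re (e (s * x)))\<^sup>2 + (Im (e (s * x)))\<^sup>2 = 1"
    using norm_e[of "s * x"] by (simp add: cmod_def)
  then show ?thesis
    by (simp add: cos_weight_def norm_divide power_divide cmod_power2 power2_sum)
qed

text \<open>\<open>cos_weight s ^ M\<close> is the squared modulus of a trigonometric polynomial with \<open>M + 1\<close> nonnegative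
  coefficients of sum \<open>1\<close>.\<close>

lemma mean_cos_weight_power: "mean (\<lambda>x. cos_weight s x ^ M) \<ge> 1 / (real M + 1)"
proof -
  define c where "c k = real (M choose k) / 2 ^ M" for k
  have c_nn: "c k \<ge> 0" for k by (simp add: c_def)
  have c_sum: "(\<Sum>k\<le>M. c k) = 1"
    using choose_row_sum[of M] unfolding c_def
    by (simp flip: sum_divide_distrib of_nat_sum)
  have h: "((1 + e (s * x)) / 2) ^ M = (\<Sum>k\<le>M. complex_of_real (c k) * e (s * int k * x))" for x
  proof -
    have pow: "e (s * x) ^ k = e (s * int k * x)" for k
      by (induction k) (simp_all add: algebra_simps e_add)
    have "((1 + e (s * x)) / 2) ^ M = (e (s * x) + 1) ^ M / 2 ^ M"
      by (simp add: power_divide add.commute)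
    also have "\<dots> = (\<Sum>k\<le>M. complex_of_real (c k) * e (s * int k * x))"
      by (simp add: binomial_ring pow c_def sum_divide_distrib)
    finally show ?thesis .
  qed
  have sq: "complex_of_real (cos_weight s x ^ M)
      = (\<Sum>k\<le>M. \<Sum>l\<le>M. complex_of_real (c k * c l) * e (s * (int k - int l) * x))" for x
  proof -
    have "complex_of_real (cos_weight s x ^ M) = ((1 + e (s * x)) / 2) ^ M * cnj (((1 + e (s * x)) / 2) ^ M)"
      unfolding complex_norm_square[symmetric] cos_weight_eq_norm
      by (simp only: norm_power power_mult[symmetric] mult.commute[of 2 M] of_real_power)
    also have "\<dots> = (\<Sum>k\<le>M. \<Sum>l\<le>M. (complex_of_real (c k) * e (s * int k * x))
        * (complex_of_real (c l) * e (- (s * int l * x))))"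
      unfolding h cnj_sum by (simp only: sum_product complex_cnj_mult complex_cnj_complex_of_real cnj_e)
    also have "\<dots> = (\<Sum>k\<le>M. \<Sum>l\<le>M. complex_of_real (c k * c l) * e (s * (int k - int l) * x))"
    proof (intro sum.cong refl)
      fix k l
      have "e (s * (int k - int l) * x) = e (s * int k * x) * e (- (s * int l * x))"
        by (simp add: algebra_simps flip: e_add)
      then show "(complex_of_real (c k) * e (s * int k * x)) * (complex_of_real (c l) * e (- (s * int l * x)))
          = complex_of_real (c k * c l) * e (s * (int k - int l) * x)"
        by simp
    qed
    finally show ?thesis .
  qed
  have "complex_of_real (\<Sum>x\<in>Zp. cos_weight s x ^ M)
      = (\<Sum>x\<in>Zp. \<Sum>k\<le>M. \<Sum>l\<le>M. complex_of_real (c k * c l) * e (s * (int k - int l) * x))"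
    by (simp only: of_real_sum sq)
  also have "\<dots> = (\<Sum>k\<le>M. \<Sum>x\<in>Zp. \<Sum>l\<le>M. complex_of_real (c k * c l) * e (s * (int k - int l) * x))"
    by (rule sum.swap)
  also have "\<dots> = (\<Sum>k\<le>M. \<Sum>l\<le>M. \<Sum>x\<in>Zp. complex_of_real (c k * c l) * e (s * (int k - int l) * x))"
    by (intro sum.cong refl sum.swap)
  also have "\<dots> = (\<Sum>k\<le>M. \<Sum>l\<le>M. complex_of_real (c k * c l * (if int p dvd s * (int k - int l) then real p else 0)))"
    by (intro sum.cong refl) (simp add: sum_e flip: sum_distrib_left)
  finally have "(\<Sum>x\<in>Zp. cos_weight s x ^ M)
      = (\<Sum>k\<le>M. \<Sum>l\<le>M. c k * c l * (if int p dvd s * (int k - int l) then real p else 0))"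
    by (simp only: of_real_sum[symmetric] of_real_eq_iff)
  \<comment> \<open>Different \<open>k\<close> and \<open>l\<close> may give the same frequency
    modulo \<open>p\<close>, but this only adds nonnegative terms. The diagonal gives a bound
    independent of \<open>p\<close> and \<open>s\<close>, to which Cauchy-Schwarz is then
    applied.\<close>
  also have "\<dots> \<ge> (\<Sum>k\<le>M. c k * c k * (if int p dvd s * (int k - int k) then real p else 0))"
    by (intro sum_mono member_le_sum[where f = "\<lambda>l. c _ * c l * (if int p dvd s * (int _ - int l) then real p else 0)"])
       (auto intro!: mult_nonneg_nonneg c_nn)
  finally have 1: "real p * (\<Sum>k\<le>M. (c k)\<^sup>2) \<le> (\<Sum>x\<in>Zp. cos_weight s x ^ M)"
    by (simp add: power2_eq_square sum_distrib_left mult_ac)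
  have "(\<Sum>k\<le>M. c k)\<^sup>2 \<le> (\<Sum>k\<le>M. (c k)\<^sup>2) * real (card {..M})"
    by (rule sum_squared_le_sum_of_squares)
  then have 2: "1 / (real M + 1) \<le> (\<Sum>k\<le>M. (c k)\<^sup>2)"
    by (simp add: c_sum field_simps)
  have "real p * (1 / (real M + 1)) \<le> (\<Sum>x\<in>Zp. cos_weight s x ^ M)"
    using order_trans[OF mult_left_mono[OF 2, of "real p"] 1] by simp
  then show ?thesis
    using p_pos by (simp add: mean_def field_simps)
qed

text \<open>A smooth substitute for the indicator of the Bohr set with frequencies \<open>R\<close>;
  larger \<open>M\<close> means a narrower set.\<close>

definition bohr_weight :: "int set \<Rightarrow> nat \<Rightarrow> int \<Rightarrow> real" where
  "bohr_weight R M x = (\<Prod>r\<in>R. cos_weight r x ^ M)"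

lemma bohr_weight_bounds: "0 \<le> bohr_weight R M x" "bohr_weight R M x \<le> 1"
  unfolding bohr_weight_def by (auto intro!: prod_nonneg prod_le_1 power_le_one simp: cos_weight_bounds)

lemma per_bohr_weight: "per (bohr_weight R M)"
  unfolding bohr_weight_def by (intro per_prod per_power per_cos_weight)

lemma posdef_bohr_weight: "posdef (cx (bohr_weight R M))"
  unfolding bohr_weight_def of_real_prod of_real_power
  by (intro posdef_prod posdef_power per_power per_cx per_cos_weight posdef_cos_weight)

text \<open>By \<open>mean_mult_posdef\<close> the factors are positively correlated, so the lower
  bounds for single frequencies multiply.\<close>

lemma mean_bohr_weight:
  assumes "finite R"
  shows "mean (bohr_weight R M) \<ge> (1 / (real M + 1)) ^ card R"
  using assms
proof (induction R)
  case empty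
  then show ?case using p_pos by (simp add: mean_def bohr_weight_def)
next
  case (insert s R)
  have pd: "posdef (cx (\<lambda>x. cos_weight s x ^ M))"
    unfolding of_real_power by (intro posdef_power per_cx per_cos_weight posdef_cos_weight)
  have "(1 / (real M + 1)) ^ card (insert s R) = (1 / (real M + 1)) * (1 / (real M + 1)) ^ card R"
    using insert by simp
  also have "\<dots> \<le> mean (\<lambda>x. cos_weight s x ^ M) * mean (bohr_weight R M)"
    by (intro mult_mono mean_cos_weight_power insert order_trans[OF _ mean_cos_weight_power]) auto
  also have "\<dots> \<le> mean (\<lambda>x. cos_weight s x ^ M * bohr_weight R M x)"
    by (intro mean_mult_posdef pd posdef_bohr_weight per_power per_cos_weight)
  also have "(\<lambda>x. cos_weight s x ^ M * bohr_weight R M x) = bohr_weight (insert s R) M"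
    using insert by (auto simp: bohr_weight_def)
  finally show ?case .
qed

lemma mean_bohr_weight_pos: "finite R \<Longrightarrow> mean (bohr_weight R M) > 0"
  by (rule less_le_trans[OF _ mean_bohr_weight]) auto

text \<open>The mean is 1 at exponent 0. Were a factor below 1 - \<delta> lost at every step, it
  would decay exponentially, against the polynomial lower bound of
  \<open>mean_bohr_weight\<close>.\<close>

lemma exists_stable_power:
  assumes "finite R" "card R \<le> k" "\<delta> \<le> 1" and M0: "(1 - \<delta>) ^ M0 * (real M0 + 1) ^ k < 1"
  shows "\<exists>M<M0. (1 - \<delta>) * mean (bohr_weight R M) \<le> mean (bohr_weight R (Suc M))"
proof (rule ccontr)
  assume neg: "\<not> ?thesis"
  have "mean (bohr_weight R M) \<le> (1 - \<delta>) ^ M" if "M \<le> M0" for M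
    using that
  proof (induction M)
    case 0
    then show ?case using p_pos by (simp add: mean_def bohr_weight_def)
  next
    case (Suc M)
    then have "mean (bohr_weight R (Suc M)) \<le> (1 - \<delta>) * mean (bohr_weight R M)"
      using neg by (meson Suc_le_lessD linear)
    also have "\<dots> \<le> (1 - \<delta>) * (1 - \<delta>) ^ M"
      using Suc assms by (intro mult_left_mono) auto
    finally show ?case by simp
  qed
  then have "(1 / (real M0 + 1)) ^ card R \<le> (1 - \<delta>) ^ M0"
    using order_trans[OF mean_bohr_weight[OF assms(1)]] by blast
  moreover have "(1 / (real M0 + 1)) ^ k \<le> (1 / (real M0 + 1)) ^ card R"
    using assms(2) by (intro power_decreasing) auto
  ultimately have "(1 / (real M0 + 1)) ^ k * (real M0 + 1) ^ k \<le> (1 - \<delta>) ^ M0 * (real M0 + 1) ^ k"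
    by (intro mult_right_mono) auto
  then show False using M0 by (simp flip: power_mult_distrib)
qed

text \<open>Normalise the Bohr weight at a stable exponent. The defect of the coefficient at
  \<open>r\<close> is twice the \<mu>-average of \<open>1 - cos_weight r\<close>, and that average
  is at most the relative loss of mass when the exponent grows by one, because the extra factor is
  at most \<open>cos_weight r\<close>.\<close>

lemma exists_kernel:
  assumes R: "finite R" "card R \<le> k" and \<delta>: "\<delta> \<le> 1"
    and M0: "(1 - \<delta>) ^ M0 * (real M0 + 1) ^ k < 1"
  shows "\<exists>\<mu>. per \<mu> \<and> (\<forall>x. \<mu> x \<ge> 0) \<and> mean \<mu> = 1 \<and> posdef (cx \<mu>) \<and> \<mu> 0 \<le> (real M0 + 1) ^ k
    \<and> (\<forall>r\<in>R. 1 - 2 * \<delta> \<le> Re (hat (cx \<mu>) r))"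
proof -
  obtain M where M: "M < M0" "(1 - \<delta>) * mean (bohr_weight R M) \<le> mean (bohr_weight R (Suc M))"
    using exists_stable_power[OF assms] by blast
  define m where "m = mean (bohr_weight R M)"
  define \<mu> where "\<mu> x = (1 / m) * bohr_weight R M x" for x
  have m: "m > 0" using mean_bohr_weight_pos[OF R(1)] by (simp add: m_def)
  have mean_\<mu>: "mean \<mu> = 1"
  proof -
    have "mean \<mu> = (1 / m) * m"
      using mean_cmult[of "1 / m" "bohr_weight R M"] unfolding m_def[symmetric] by (simp only: mean_def \<mu>_def)
    then show ?thesis using m by simp
  qed
  have "posdef (\<lambda>x. complex_of_real (1 / m) * cx (bohr_weight R M) x)"
    using m by (intro posdef_cmult posdef_bohr_weight) simp
  then have pd: "posdef (cx \<mu>)" by (simp add: \<mu>_def)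
  have "1 / (real M0 + 1) ^ k \<le> (1 / (real M + 1)) ^ card R"
  proof -
    have "(1 / (real M0 + 1)) ^ k \<le> (1 / (real M0 + 1)) ^ card R"
      using R by (intro power_decreasing) auto
    also have "\<dots> \<le> (1 / (real M + 1)) ^ card R"
      using M by (intro power_mono frac_le) auto
    finally show ?thesis by (simp add: power_one_over)
  qed
  also have "\<dots> \<le> m" unfolding m_def by (rule mean_bohr_weight[OF R(1)])
  finally have "\<mu> 0 \<le> (real M0 + 1) ^ k"
    using m by (simp add: \<mu>_def bohr_weight_def field_simps)
  moreover have "1 - 2 * \<delta> \<le> Re (hat (cx \<mu>) r)" if r: "r \<in> R" for r
  proof -
    have "Re (hat (cx \<mu>) r) = (\<Sum>x\<in>Zp. \<mu> x * (2 * cos_weight r x - 1)) / real p"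
    proof -
      have "Re (e (- (r * x))) = 2 * cos_weight r x - 1" for x
        by (simp add: cos_weight_def e_def field_simps)
      then show ?thesis by (simp add: hat_def)
    qed
    also have "\<dots> = (\<Sum>x\<in>Zp. \<mu> x - 2 * (\<mu> x * (1 - cos_weight r x))) / real p"
      by (intro arg_cong2[where f = "(/)"] sum.cong refl) (simp add: algebra_simps)
    also have "\<dots> = 1 - 2 * mean (\<lambda>x. \<mu> x * (1 - cos_weight r x))"
      using mean_\<mu> by (simp add: mean_def sum_subtractf diff_divide_distrib flip: sum_distrib_left)
    finally have eq: "Re (hat (cx \<mu>) r) = 1 - 2 * mean (\<lambda>x. \<mu> x * (1 - cos_weight r x))" .
    have "mean (\<lambda>x. \<mu> x * (1 - cos_weight r x)) \<le> mean (\<lambda>x. (bohr_weight R M x - bohr_weight R (Suc M) x) / m)"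
    proof (rule mean_mono)
      fix x
      have "(\<Prod>s\<in>R. cos_weight s x) \<le> cos_weight r x"
      proof -
        have "(\<Prod>s\<in>R - {r}. cos_weight s x) \<le> 1"
          by (intro prod_le_1) (auto simp: cos_weight_bounds)
        then have "cos_weight r x * (\<Prod>s\<in>R - {r}. cos_weight s x) \<le> cos_weight r x"
          using mult_left_mono[of _ 1 "cos_weight r x"] cos_weight_bounds by fastforce
        then show ?thesis using prod.remove[OF R(1) r, of "\<lambda>s. cos_weight s x"] by simp
      qed
      then have "bohr_weight R M x * (1 - cos_weight r x) \<le> bohr_weight R M x * (1 - (\<Prod>s\<in>R. cos_weight s x))"
        by (intro mult_left_mono bohr_weight_bounds) auto
      also have "\<dots> = bohr_weight R M x - bohr_weight R (Suc M) x"
        by (simp add: bohr_weight_def prod.distrib algebra_simps)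
      finally show "\<mu> x * (1 - cos_weight r x) \<le> (bohr_weight R M x - bohr_weight R (Suc M) x) / m"
        using m by (simp add: \<mu>_def divide_right_mono)
    qed
    also have "\<dots> = (m - mean (bohr_weight R (Suc M))) / m"
      using mean_cmult[of "1 / m" "\<lambda>x. bohr_weight R M x - bohr_weight R (Suc M) x"]
      by (simp add: mean_diff flip: m_def)
    also have "\<dots> \<le> \<delta>"
      using m M(2) by (simp add: m_def field_simps)
    finally show ?thesis using eq by simp
  qed
  moreover have "per \<mu>" using per_bohr_weight by (simp add: per_def \<mu>_def)
  moreover have "\<mu> x \<ge> 0" for x using m bohr_weight_bounds by (simp add: \<mu>_def)
  ultimately show ?thesis using mean_\<mu> pd by blast
qed

subsection \<open>Smoothing a set\<close>

definition ind :: "int set \<Rightarrow> int \<Rightarrow> real" where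
  "ind A x = of_bool (x mod int p \<in> A)"

lemma per_ind: "per (ind A)"
  by (simp add: per_def ind_def)

lemma ind_bounds: "0 \<le> ind A x" "ind A x \<le> 1"
  by (auto simp: ind_def)

lemma sum_ind_mult:
  assumes "A \<subseteq> Zp"
  shows "(\<Sum>x\<in>Zp. ind A x * f x) = (\<Sum>x\<in>A. f x)"
  by (intro sum.mono_neutral_cong_right) (use assms in \<open>auto simp: ind_def subset_iff\<close>)

lemma sum_ind: "A \<subseteq> Zp \<Longrightarrow> (\<Sum>x\<in>Zp. ind A x) = real (card A)"
  using sum_ind_mult[of A "\<lambda>_. 1"] by simp

definition schur :: "(int \<Rightarrow> real) \<Rightarrow> real" where
  "schur f = (\<Sum>x\<in>Zp. \<Sum>y\<in>Zp. f x * f y * f (x + y))"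

lemma schur_hat:
  assumes "per f"
  shows "complex_of_real (schur f) = (of_nat p)\<^sup>2 * (\<Sum>r\<in>Zp. (hat (cx f) r)\<^sup>2 * cnj (hat (cx f) r))"
  unfolding schur_fourier[OF per_cx[OF assms], symmetric] by (simp add: schur_def)

lemma parseval_ind:
  assumes "A \<subseteq> Zp"
  shows "(\<Sum>r\<in>Zp. (norm (hat (cx (ind A)) r))\<^sup>2) = real (card A) / real p"
proof -
  have "(\<Sum>x\<in>Zp. (norm (cx (ind A) x))\<^sup>2) = (\<Sum>x\<in>Zp. ind A x)"
    by (intro sum.cong refl) (simp add: ind_def)
  then show ?thesis
    using parseval[OF per_cx[OF per_ind], of A] sum_ind[OF assms] p_pos by (simp add: field_simps)
qed

lemma parseval_ind_le_1: "A \<subseteq> Zp \<Longrightarrow> (\<Sum>r\<in>Zp. (norm (hat (cx (ind A)) r))\<^sup>2) \<le> 1"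
  using card_mono[of Zp A] p_pos by (simp add: parseval_ind)

text \<open>This is what makes the exceptional set in \<open>smoothing\<close> small.\<close>

lemma posdef_energy:
  assumes "B \<subseteq> Zp" "per \<mu>" "posdef (cx \<mu>)"
  shows "(real (card B))\<^sup>2 * mean \<mu> \<le> (\<Sum>x\<in>B. \<Sum>y\<in>Zp. ind B y * \<mu> (x - y))"
proof -
  let ?F = "\<lambda>x. (\<Sum>y\<in>Zp. cx (ind B) y * cx \<mu> (x - y)) / of_nat p"
  let ?b = "hat (cx (ind B))"
  have b0: "?b 0 = of_real (real (card B) / real p)"
    using sum_ind[OF assms(1)] by (simp add: hat_cx_0 mean_def)
  have "complex_of_real ((\<Sum>x\<in>B. \<Sum>y\<in>Zp. ind B y * \<mu> (x - y)) / real p)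
      = (\<Sum>x\<in>Zp. ?F x * cnj (cx (ind B) x))"
    unfolding sum_ind_mult[OF assms(1), symmetric] by (simp add: sum_divide_distrib sum_distrib_left mult_ac)
  also have "\<dots> = of_nat p * (\<Sum>r\<in>Zp. hat ?F r * cnj (?b r))"
    by (rule plancherel[OF per_cx[OF per_ind]])
  also have "\<dots> = of_nat p * (\<Sum>r\<in>Zp. hat (cx \<mu>) r * of_real ((norm (?b r))\<^sup>2))"
    unfolding hat_convolution[OF per_cx[OF assms(2)]] complex_norm_square by (simp only: mult_ac)
  finally have "Re (complex_of_real ((\<Sum>x\<in>B. \<Sum>y\<in>Zp. ind B y * \<mu> (x - y)) / real p))
      = Re (of_nat p * (\<Sum>r\<in>Zp. hat (cx \<mu>) r * of_real ((norm (?b r))\<^sup>2)))"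
    by (rule arg_cong)
  then have eq: "(\<Sum>x\<in>B. \<Sum>y\<in>Zp. ind B y * \<mu> (x - y)) / real p
      = real p * (\<Sum>r\<in>Zp. Re (hat (cx \<mu>) r) * (norm (?b r))\<^sup>2)"
    by simp
  \<comment> \<open>All terms are nonnegative, so frequency 0 alone gives the bound.\<close>
  have "Re (hat (cx \<mu>) 0) * (norm (?b 0))\<^sup>2 \<le> (\<Sum>r\<in>Zp. Re (hat (cx \<mu>) r) * (norm (?b r))\<^sup>2)"
    using p_pos assms(3)
    by (intro member_le_sum[where f = "\<lambda>r. Re (hat (cx \<mu>) r) * (norm (?b r))\<^sup>2"])
       (auto simp: posdef_def complex_nonneg_Reals_iff)
  then have "mean \<mu> * (real (card B) / real p)\<^sup>2 * real p \<le> (\<Sum>x\<in>B. \<Sum>y\<in>Zp. ind B y * \<mu> (x - y)) / real p"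
    unfolding eq b0 hat_cx_0 norm_of_real power2_abs Re_complex_of_real
    using p_pos by (simp add: mult.commute)
  then show ?thesis
    using p_pos by (simp add: field_simps power2_eq_square)
qed

text \<open>Convolution with the kernel multiplies each coefficient by some m between 0 and 1. The
  Schur sum is cubic in the coefficients, so two factors are spent on Parseval and the third, times
  1 - m^3, must be small: at large frequencies m is near 1, elsewhere the coefficient itself is
  below \<delta>.\<close>

lemma smoothing:
  assumes A: "A \<subseteq> Zp" and \<delta>: "0 < \<delta>" "\<delta> \<le> 1" and k: "1 / \<delta>\<^sup>2 \<le> real k"
    and M0: "(1 - \<delta>) ^ M0 * (real M0 + 1) ^ k < 1"
  shows "\<exists>f. per f \<and> (\<forall>x. 0 \<le> f x \<and> f x \<le> 1) \<and> wiener (cx f) \<le> (real M0 + 1) ^ k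
    \<and> schur f \<le> schur (ind A) + 6 * \<delta> * (real p)\<^sup>2
    \<and> (\<forall>\<epsilon>\<ge>0. real (card {x\<in>A. f x < \<epsilon>}) \<le> \<epsilon> * real p)"
proof -
  let ?a = "hat (cx (ind A))"
  define R where "R = {r\<in>Zp. \<delta> \<le> norm (?a r)}"
  have R: "finite R" by (rule finite_subset[of _ Zp]) (auto simp: R_def)
  \<comment> \<open>By Parseval, at most 1/\<delta>^2 frequencies are large, independently of
    \<open>p\<close>.\<close>
  have "real (card R) * \<delta>\<^sup>2 = (\<Sum>r\<in>R. \<delta>\<^sup>2)" by simp
  also have "\<dots> \<le> (\<Sum>r\<in>R. (norm (?a r))\<^sup>2)"
    using \<delta> by (intro sum_mono power_mono) (auto simp: R_def)
  also have "\<dots> \<le> (\<Sum>r\<in>Zp. (norm (?a r))\<^sup>2)"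
    by (intro sum_mono2) (auto simp: R_def)
  also have "\<dots> \<le> 1" by (rule parseval_ind_le_1[OF A])
  finally have "real (card R) \<le> 1 / \<delta>\<^sup>2"
    using \<delta> by (simp add: field_simps)
  then have cardR: "card R \<le> k"
    using k by linarith
  obtain \<mu> where \<mu>: "per \<mu>" "\<And>x. \<mu> x \<ge> 0" "mean \<mu> = 1" "posdef (cx \<mu>)"
    "\<mu> 0 \<le> (real M0 + 1) ^ k" "\<And>r. r \<in> R \<Longrightarrow> 1 - 2 * \<delta> \<le> Re (hat (cx \<mu>) r)"
    using exists_kernel[OF R cardR \<delta>(2) M0] by blast
  define m where "m r = Re (hat (cx \<mu>) r)" for r
  have hat_\<mu>: "hat (cx \<mu>) r = complex_of_real (m r)" and m_nn: "m r \<ge> 0" for r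
    using \<mu>(4) by (auto simp: posdef_def complex_nonneg_Reals_iff m_def complex_eq_iff)
  have m_le: "m r \<le> 1" for r
    using norm_hat_le[of "cx \<mu>" r] \<mu>(2,3) m_nn by (simp add: hat_\<mu>)
  \<comment> \<open>Inversion at 0 identifies the Wiener norm of the nonnegative-coefficient kernel
    with its value there.\<close>
  have "complex_of_real (\<mu> 0) = complex_of_real (\<Sum>r\<in>Zp. m r)"
    using fourier_inversion[OF per_cx[OF \<mu>(1)], of 0] by (simp add: hat_\<mu>)
  then have sum_m: "(\<Sum>r\<in>Zp. m r) = \<mu> 0" by (simp only: of_real_eq_iff)
  define f where "f x = (\<Sum>y\<in>Zp. ind A y * \<mu> (x - y)) / real p" for x
  have sum_\<mu>: "(\<Sum>y\<in>Zp. \<mu> (x - y)) = real p" for x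
    using sum_reflect[OF \<mu>(1), of x] \<mu>(3) p_pos by (simp add: mean_def)
  have per_f: "per f"
    unfolding per_def f_def
    by (intro allI arg_cong2[where f = "(/)"] arg_cong2[where f = "(*)"] sum.cong refl per_cong[OF \<mu>(1)])
       (simp add: mod_diff_left_eq)
  have f_nn: "f x \<ge> 0" for x
    unfolding f_def by (intro divide_nonneg_nonneg sum_nonneg mult_nonneg_nonneg ind_bounds \<mu>(2)) auto
  have f_le: "f x \<le> 1" for x
  proof -
    have "(\<Sum>y\<in>Zp. ind A y * \<mu> (x - y)) \<le> (\<Sum>y\<in>Zp. \<mu> (x - y))"
      by (intro sum_mono mult_left_le_one_le ind_bounds \<mu>(2))
    then show ?thesis using p_pos by (simp add: f_def sum_\<mu>)
  qed
  have hat_f: "hat (cx f) r = ?a r * complex_of_real (m r)" for r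
    using hat_convolution[OF per_cx[OF \<mu>(1)], of "cx (ind A)" r] by (simp add: f_def hat_\<mu>)
  have a_le: "norm (?a r) \<le> 1" for r
  proof -
    have "norm (?a r) \<le> mean (\<lambda>x. 1)"
      using ind_bounds by (intro order_trans[OF norm_hat_le] mean_mono) auto
    then show ?thesis using p_pos by (simp add: mean_def)
  qed
  have "wiener (cx f) \<le> (\<Sum>r\<in>Zp. m r)"
    unfolding wiener_def hat_f
    by (intro sum_mono) (use a_le m_nn in \<open>simp add: norm_mult mult_left_le_one_le\<close>)
  then have wiener_f: "wiener (cx f) \<le> (real M0 + 1) ^ k"
    using sum_m \<mu>(5) by simp
  have schur_f: "schur f \<le> schur (ind A) + 6 * \<delta> * (real p)\<^sup>2"
  proof -
    have bnd: "norm ((?a r)\<^sup>2 * cnj (?a r) * of_real (m r ^ 3 - 1)) \<le> 6 * \<delta> * (norm (?a r))\<^sup>2"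
      if r: "r \<in> Zp" for r
    proof -
      have "1 - m r ^ 3 = (1 - m r) * (1 + m r + (m r)\<^sup>2)"
        by (simp add: power3_eq_cube power2_eq_square algebra_simps)
      also have "\<dots> \<le> (1 - m r) * 3"
        using m_nn[of r] m_le[of r] power_le_one[of "m r" 2] by (intro mult_left_mono) auto
      finally have m3: "1 - m r ^ 3 \<le> 3 * (1 - m r)" by simp
      have m3': "0 \<le> 1 - m r ^ 3" "1 - m r ^ 3 \<le> 1"
        using m_nn[of r] m_le[of r] by (auto intro: power_le_one)
      have "norm (?a r) * (1 - m r ^ 3) \<le> 6 * \<delta>"
      proof (cases "r \<in> R")
        case True
        have "norm (?a r) * (1 - m r ^ 3) \<le> 1 * (1 - m r ^ 3)"
          by (intro mult_right_mono a_le m3')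
        also have "\<dots> \<le> 6 * \<delta>"
          using m3 \<mu>(6)[OF True] by (simp add: m_def)
        finally show ?thesis .
      next
        case False
        then have "norm (?a r) \<le> \<delta>" using r by (simp add: R_def)
        then have "norm (?a r) * (1 - m r ^ 3) \<le> \<delta> * 1"
          using m3' \<delta> by (intro mult_mono) auto
        then show ?thesis using \<delta> by simp
      qed
      then have "(norm (?a r))\<^sup>2 * (norm (?a r) * (1 - m r ^ 3)) \<le> (norm (?a r))\<^sup>2 * (6 * \<delta>)"
        by (intro mult_left_mono) auto
      moreover have "\<bar>m r ^ 3 - 1\<bar> = 1 - m r ^ 3" using m3' by simp
      ultimately show ?thesis
        by (simp add: norm_mult norm_power mult_ac del: of_real_diff of_real_power)
    qed
    have "complex_of_real (schur f - schur (ind A))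
        = (of_nat p)\<^sup>2 * (\<Sum>r\<in>Zp. (?a r)\<^sup>2 * cnj (?a r) * of_real (m r ^ 3 - 1))"
      unfolding of_real_diff schur_hat[OF per_f] schur_hat[OF per_ind] hat_f
        right_diff_distrib[symmetric] sum_subtractf[symmetric]
      by (intro arg_cong2[where f = "(*)"] sum.cong refl)
         (simp add: power2_eq_square power3_eq_cube algebra_simps)
    then have "\<bar>schur f - schur (ind A)\<bar>
        = norm ((of_nat p)\<^sup>2 * (\<Sum>r\<in>Zp. (?a r)\<^sup>2 * cnj (?a r) * complex_of_real (m r ^ 3 - 1)))"
      by (metis norm_of_real)
    also have "\<dots> = (real p)\<^sup>2 * norm (\<Sum>r\<in>Zp. (?a r)\<^sup>2 * cnj (?a r) * complex_of_real (m r ^ 3 - 1))"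
      by (simp only: norm_mult norm_power norm_of_nat)
    also have "\<dots> \<le> (real p)\<^sup>2 * (\<Sum>r\<in>Zp. 6 * \<delta> * (norm (?a r))\<^sup>2)"
      by (intro mult_left_mono order_trans[OF norm_sum] sum_mono bnd) auto
    also have "\<dots> = (real p)\<^sup>2 * (6 * \<delta>) * (\<Sum>r\<in>Zp. (norm (?a r))\<^sup>2)"
      by (simp only: sum_distrib_left mult.assoc)
    also have "\<dots> \<le> (real p)\<^sup>2 * (6 * \<delta>) * 1"
      using \<delta> by (intro mult_left_mono parseval_ind_le_1[OF A]) auto
    finally show ?thesis by (simp add: mult_ac)
  qed
  \<comment> \<open>Count the \<mu>-weighted pairs within the exceptional set B:
    \<open>posdef_energy\<close> gives at least |B|^2, while enlarging the second set to
    \<open>A\<close> gives at most |B| \<epsilon> p.\<close>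
  have "real (card {x\<in>A. f x < \<epsilon>}) \<le> \<epsilon> * real p" if "\<epsilon> \<ge> 0" for \<epsilon>
  proof -
    let ?B = "{x\<in>A. f x < \<epsilon>}"
    have B: "?B \<subseteq> Zp" using A by auto
    have "(real (card ?B))\<^sup>2 \<le> (\<Sum>x\<in>?B. \<Sum>y\<in>Zp. ind ?B y * \<mu> (x - y))"
      using posdef_energy[OF B \<mu>(1,4)] \<mu>(3) by simp
    also have "\<dots> \<le> (\<Sum>x\<in>?B. \<Sum>y\<in>Zp. ind A y * \<mu> (x - y))"
      by (intro sum_mono mult_right_mono \<mu>(2)) (auto simp: ind_def)
    also have "\<dots> = (\<Sum>x\<in>?B. real p * f x)"
      using p_pos by (simp add: f_def)
    also have "\<dots> \<le> (\<Sum>x\<in>?B. real p * \<epsilon>)"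
      by (intro sum_mono mult_left_mono) auto
    finally have "real (card ?B) * real (card ?B) \<le> real (card ?B) * (\<epsilon> * real p)"
      by (simp add: power2_eq_square mult_ac)
    then show ?thesis
      using that by (cases "card ?B = 0") auto
  qed
  then show ?thesis
    using per_f f_nn f_le wiener_f schur_f by blast
qed

end

subsection \<open>The density bound\<close>

context prime_fourier
begin

lemma schur_mono:
  assumes "\<And>x. 0 \<le> g x" "\<And>x. g x \<le> c * f x"
  shows "schur g \<le> c ^ 3 * schur f"
proof -
  have "schur g \<le> (\<Sum>x\<in>Zp. \<Sum>y\<in>Zp. (c * f x) * (c * f y) * (c * f (x + y)))"
    unfolding schur_def
    by (intro sum_mono mult_mono assms mult_nonneg_nonneg order_trans[OF assms(1,2)])
  also have "\<dots> = c ^ 3 * schur f"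
    by (simp add: schur_def sum_distrib_left power3_eq_cube mult_ac)
  finally show ?thesis .
qed

text \<open>If the level set \<open>B\<close> had density above 1/3 + \<epsilon>, it would contain
  at least (\<epsilon> p)^2 Schur triples, each contributing \<epsilon>^3. Outside \<open>B\<close>
  the function adds at most \<epsilon> to the mean.\<close>

lemma mean_le_of_schur:
  assumes g: "per g" "\<And>x. 0 \<le> g x" "\<And>x. g x \<le> 1"
    and \<epsilon>: "0 < \<epsilon>" "\<epsilon> \<le> 1/12" and p: "1 \<le> \<epsilon> * real p"
    and schur_g: "schur g < \<epsilon> ^ 5 * (real p)\<^sup>2"
  shows "mean g \<le> 1/3 + 2 * \<epsilon>"
proof -
  define B where "B = {x\<in>Zp. \<epsilon> \<le> g x}"
  have B: "B \<subseteq> Zp" by (auto simp: B_def)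
  have "real (card B) \<le> (1/3 + \<epsilon>) * real p"
  proof (rule ccontr)
    assume large: "\<not> ?thesis"
    define m where "m = nat \<lceil>(1/3 + \<epsilon>) * real p\<rceil>"
    define t where "t = nat \<lceil>\<epsilon> * real p\<rceil>"
    have pos: "0 \<le> (1/3 + \<epsilon>) * real p" "0 \<le> \<epsilon> * real p"
      using \<epsilon> by auto
    have m: "(1/3 + \<epsilon>) * real p \<le> real m" "real m < (1/3 + \<epsilon>) * real p + 1"
      unfolding m_def using pos by linarith+
    have t: "\<epsilon> * real p \<le> real t" "real t < \<epsilon> * real p + 1"
      unfolding t_def using pos by linarith+
    have mB: "m \<le> card B"
      using large m_def by linarith
    \<comment> \<open>The bound 1/12 comes from here: rounding costs 1, which is at most \<epsilon>
      p, and 1/3 + 1/12 + 1/12 = 1/2 gives \<open>2 * m \<le> p\<close>.\<close>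
    have ep: "\<epsilon> * real p \<le> 1/12 * real p"
      using \<epsilon> by (intro mult_right_mono) auto
    have "real (2 * m) \<le> real p"
      using m(2) ep p by (simp add: algebra_simps)
    then have m2: "2 * m \<le> p" by (simp only: of_nat_le_iff)
    have tm: "t \<le> m"
      unfolding m_def t_def by (intro nat_mono ceiling_mono mult_right_mono) auto
    \<comment> \<open>The second factor exceeds 2 \<epsilon> p - 1, which is at least \<epsilon>
      p.\<close>
    have "(\<epsilon> * real p) * (\<epsilon> * real p) \<le> real t * (3 * real m - real p - real t)"
      using m t p pos by (intro mult_mono) (auto simp: algebra_simps)
    also have "\<dots> \<le> (\<Sum>x\<in>Zp. \<Sum>y\<in>Zp. of_bool (x \<in> B \<and> y \<in> B \<and> (x + y) mod int p \<in> B))"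
      by (rule schur_count_lower[OF B mB m2 tm])
    finally have "\<epsilon> ^ 3 * ((\<epsilon> * real p) * (\<epsilon> * real p))
        \<le> \<epsilon> ^ 3 * (\<Sum>x\<in>Zp. \<Sum>y\<in>Zp. of_bool (x \<in> B \<and> y \<in> B \<and> (x + y) mod int p \<in> B))"
      using \<epsilon> by (intro mult_left_mono) auto
    also have "\<dots> \<le> schur g"
      unfolding schur_def sum_distrib_left
    proof (intro sum_mono)
      fix x y
      show "\<epsilon> ^ 3 * of_bool (x \<in> B \<and> y \<in> B \<and> (x + y) mod int p \<in> B) \<le> g x * g y * g (x + y)"
      proof (cases "x \<in> B \<and> y \<in> B \<and> (x + y) mod int p \<in> B")
        case True
        then have "\<epsilon> \<le> g x" "\<epsilon> \<le> g y" "\<epsilon> \<le> g (x + y)"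
          using perD[OF g(1), of "x + y"] by (auto simp: B_def)
        then have "\<epsilon> * \<epsilon> * \<epsilon> \<le> g x * g y * g (x + y)"
          using \<epsilon> g(2) by (intro mult_mono) auto
        then show ?thesis using True by (simp add: power3_eq_cube)
      qed (use g(2) in auto)
    qed
    also have "\<dots> < \<epsilon> ^ 5 * (real p)\<^sup>2" by (rule schur_g)
    finally show False
      by (simp add: power2_eq_square eval_nat_numeral mult_ac)
  qed
  moreover have "(\<Sum>x\<in>Zp. g x) \<le> (\<Sum>x\<in>Zp. of_bool (x \<in> B) + \<epsilon>)"
  proof (rule sum_mono)
    fix x assume "x \<in> Zp"
    then show "g x \<le> of_bool (x \<in> B) + \<epsilon>"
      using g(3)[of x] \<epsilon>(1) by (auto simp: B_def)
  qed
  moreover have "(\<Sum>x\<in>Zp. of_bool (x \<in> B) + \<epsilon>) = real (card B) + \<epsilon> * real p"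
    using B by (simp add: sum.distrib Int_absorb1)
  ultimately show ?thesis
    using p_pos by (simp add: mean_def field_simps)
qed

lemma sum_inverse_le:
  assumes g: "per g"
  shows "(\<Sum>x\<in>Zpx. g x * g (minv x))
    \<le> real p * (mean g)\<^sup>2 + root 4 (3 * real p ^ 3) * (wiener (cx g))\<^sup>2"
proof -
  let ?S = "\<Sum>x\<in>Zpx. g x * g (minv x)"
  have "\<bar>?S - real (p - 1) * (mean g)\<^sup>2\<bar>
      = norm (complex_of_real (?S - real (p - 1) * (mean g)\<^sup>2))"
    by (simp only: norm_of_real)
  also have "complex_of_real (?S - real (p - 1) * (mean g)\<^sup>2)
      = (\<Sum>x\<in>Zpx. cx g x * cx g (minv x)) - of_nat (p - 1) * (hat (cx g) 0)\<^sup>2"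
    by (simp add: hat_cx_0 del: of_nat_diff)
  also have "norm \<dots> \<le> root 4 (3 * real p ^ 3) * (wiener (cx g))\<^sup>2"
    by (rule inverse_equidistribution[OF per_cx[OF g]])
  finally have "?S \<le> real (p - 1) * (mean g)\<^sup>2 + root 4 (3 * real p ^ 3) * (wiener (cx g))\<^sup>2"
    by linarith
  also have "real (p - 1) * (mean g)\<^sup>2 \<le> real p * (mean g)\<^sup>2"
    by (intro mult_right_mono) auto
  finally show ?thesis by simp
qed

lemma card_bound:
  assumes A: "A \<subseteq> Zpx" and sf: "\<And>x y. x \<in> A \<Longrightarrow> y \<in> A \<Longrightarrow> (x + y) mod int p \<notin> A"
    and inv: "\<And>x. x \<in> A \<Longrightarrow> minv x \<in> A"
    and \<epsilon>: "0 < \<epsilon>" "\<epsilon> \<le> 1/12" and N: "(1 - \<epsilon>) ^ N \<le> \<epsilon> / 2"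
    and \<delta>: "0 < \<delta>" "\<delta> \<le> 1" "real N ^ 3 * (6 * \<delta>) < \<epsilon> ^ 5"
    and k: "1 / \<delta>\<^sup>2 \<le> real k" and M0: "(1 - \<delta>) ^ M0 * (real M0 + 1) ^ k < 1"
    and p: "1 \<le> \<epsilon> * real p"
    and K: "root 4 (3 * real p ^ 3) * (1 + (1 + (real M0 + 1) ^ k) ^ N)\<^sup>2 \<le> \<epsilon> * real p"
  shows "real (card A) \<le> (1/9 + 9 * \<epsilon>) * real p"
proof -
  have AZ: "A \<subseteq> Zp" using A by auto
  have finA: "finite A" using AZ finite_subset by blast
  obtain f where f: "per f" "\<And>x. 0 \<le> f x" "\<And>x. f x \<le> 1" "wiener (cx f) \<le> (real M0 + 1) ^ k"
    and schur_f: "schur f \<le> schur (ind A) + 6 * \<delta> * (real p)\<^sup>2"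
    and exc: "\<And>\<epsilon>. \<epsilon> \<ge> 0 \<Longrightarrow> real (card {x\<in>A. f x < \<epsilon>}) \<le> \<epsilon> * real p"
    using smoothing[OF AZ \<delta>(1,2) k M0] by blast
  have "schur (ind A) = 0"
    unfolding schur_def
  proof (intro sum.neutral ballI)
    fix x y assume "x \<in> Zp" "y \<in> Zp"
    then show "ind A x * ind A y * ind A (x + y) = 0"
      using sf[of x y] by (auto simp: ind_def)
  qed
  define g where "g x = 1 - (1 - f x) ^ N" for x
  have g: "per g" "0 \<le> g x" "g x \<le> 1" for x
    using f(1-3) by (auto simp: per_def g_def intro: power_le_one)
  \<comment> \<open>Bernoulli's inequality; the price for boosting \<open>f\<close> to
    \<open>g\<close> is thus a factor N^3 in the Schur sum.\<close>
  have g_le: "g x \<le> real N * f x" for x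
    using Bernoulli_inequality[of "- f x" N] f(3)[of x] by (simp add: g_def)
  have "schur g \<le> real N ^ 3 * schur f"
    by (rule schur_mono[OF g(2) g_le])
  also have "\<dots> \<le> real N ^ 3 * (6 * \<delta> * (real p)\<^sup>2)"
    using schur_f \<open>schur (ind A) = 0\<close> by (intro mult_left_mono) auto
  also have "\<dots> < \<epsilon> ^ 5 * (real p)\<^sup>2"
    using mult_strict_right_mono[OF \<delta>(3), of "(real p)\<^sup>2"] p_pos by (simp add: mult_ac)
  finally have mean_g: "mean g \<le> 1/3 + 2 * \<epsilon>"
    by (rule mean_le_of_schur[OF g \<epsilon> p])
  have mean_nn: "0 \<le> mean g"
    using g(2) by (simp add: mean_def sum_nonneg)
  have per1: "per (\<lambda>x. 1 - cx f x)" using f(1) by (simp add: per_def)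
  have "wiener (cx g) = wiener (\<lambda>x. 1 - (1 - cx f x) ^ N)"
    by (simp add: g_def)
  also have "\<dots> \<le> 1 + wiener (\<lambda>x. 1 - cx f x) ^ N"
    using wiener_one_minus[of "\<lambda>x. (1 - cx f x) ^ N"] wiener_power[OF per1, of N] by linarith
  also have "\<dots> \<le> 1 + (1 + (real M0 + 1) ^ k) ^ N"
    using wiener_one_minus[of "cx f"] f(4) wiener_nonneg
    by (intro add_left_mono power_mono) auto
  finally have "root 4 (3 * real p ^ 3) * (wiener (cx g))\<^sup>2 \<le> \<epsilon> * real p"
    using wiener_nonneg by (intro order_trans[OF mult_left_mono[OF power_mono] K]) auto
  moreover have "real p * (mean g)\<^sup>2 \<le> real p * (1/3 + 2 * \<epsilon>)\<^sup>2"
    using mean_g mean_nn by (intro mult_left_mono power_mono) auto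
  ultimately have S: "(\<Sum>x\<in>Zpx. g x * g (minv x)) \<le> real p * (1/3 + 2 * \<epsilon>)\<^sup>2 + \<epsilon> * real p"
    using sum_inverse_le[OF g(1)] by linarith
  let ?A1 = "{x\<in>A. f x < \<epsilon>}" and ?A2 = "{x\<in>A. \<epsilon> \<le> f x \<and> \<epsilon> \<le> f (minv x)}"
  \<comment> \<open>An element is bad if \<open>f\<close> is small at it or at its inverse; by
    closure under inversion the second kind is the image of the first.\<close>
  have "A \<subseteq> ?A1 \<union> minv ` ?A1 \<union> ?A2"
  proof
    fix x assume x: "x \<in> A"
    then have "x = minv (minv x)" using A minv_minv by auto
    then show "x \<in> ?A1 \<union> minv ` ?A1 \<union> ?A2"
      using x inv[OF x] by (cases "f (minv x) < \<epsilon>") (auto simp: not_less)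
  qed
  then have "card A \<le> card (?A1 \<union> minv ` ?A1 \<union> ?A2)"
    using finA by (intro card_mono) auto
  also have "\<dots> \<le> card ?A1 + card (minv ` ?A1) + card ?A2"
    by (rule order_trans[OF card_Un_le]) (intro add_mono card_Un_le order_refl)
  also have "\<dots> \<le> card ?A1 + card ?A1 + card ?A2"
    using finA by (intro add_mono card_image_le) auto
  finally have "real (card A) \<le> 2 * real (card ?A1) + real (card ?A2)" by linarith
  moreover have "real (card ?A1) \<le> \<epsilon> * real p" using exc \<epsilon> by simp
  \<comment> \<open>Here both values of \<open>g\<close> are at least 1 - \<epsilon>/2, so their
    product is at least 1 - \<epsilon>; dropping that factor costs at most \<epsilon> p.\<close>
  moreover have "real (card ?A2) \<le> (\<Sum>x\<in>Zpx. g x * g (minv x)) + \<epsilon> * real p"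
  proof -
    have g_ge: "1 - \<epsilon> / 2 \<le> g x" if "\<epsilon> \<le> f x" for x
    proof -
      have "(1 - f x) ^ N \<le> (1 - \<epsilon>) ^ N"
        using that f(3)[of x] by (intro power_mono) auto
      then show ?thesis using N by (simp add: g_def)
    qed
    have "real (card ?A2) * (1 - \<epsilon>) \<le> (\<Sum>x\<in>?A2. g x * g (minv x))"
    proof -
      have "1 - \<epsilon> \<le> g x * g (minv x)" if "x \<in> ?A2" for x
      proof -
        have "1 - \<epsilon> \<le> (1 - \<epsilon> / 2) * (1 - \<epsilon> / 2)"
          by (simp add: algebra_simps)
        also have "\<dots> \<le> g x * g (minv x)"
          using that \<epsilon> g(2) by (intro mult_mono g_ge) auto
        finally show ?thesis .
      qed
      then show ?thesis
        using sum_mono[of ?A2 "\<lambda>_. 1 - \<epsilon>" "\<lambda>x. g x * g (minv x)"] by simp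
    qed
    also have "\<dots> \<le> (\<Sum>x\<in>Zpx. g x * g (minv x))"
      using A g(2) by (intro sum_mono2 mult_nonneg_nonneg) auto
    finally have "real (card ?A2) * (1 - \<epsilon>) \<le> (\<Sum>x\<in>Zpx. g x * g (minv x))" .
    moreover have "real (card ?A2) * \<epsilon> \<le> real p * \<epsilon>"
    proof -
      have "card ?A2 \<le> card Zp" using AZ by (intro card_mono) auto
      then show ?thesis using \<epsilon> by (intro mult_right_mono) auto
    qed
    ultimately show ?thesis by (simp add: algebra_simps)
  qed
  ultimately have "real (card A) \<le> real p * (4 * \<epsilon> + (1/3 + 2 * \<epsilon>)\<^sup>2)"
    using S by (simp add: algebra_simps)
  also have "\<dots> \<le> real p * (1/9 + 9 * \<epsilon>)"
  proof (rule mult_left_mono)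
    have "\<epsilon> * \<epsilon> \<le> 1/12 * \<epsilon>" using \<epsilon> by (intro mult_right_mono) auto
    moreover have "4 * \<epsilon> + (1/3 + 2 * \<epsilon>)\<^sup>2 = 1/9 + 16/3 * \<epsilon> + 4 * (\<epsilon> * \<epsilon>)"
      by (simp add: power2_eq_square algebra_simps)
    ultimately show "4 * \<epsilon> + (1/3 + 2 * \<epsilon>)\<^sup>2 \<le> 1/9 + 9 * \<epsilon>"
      using \<epsilon> by linarith
  qed simp
  finally show ?thesis by (simp add: mult.commute)
qed

end

section \<open>Choice of parameters and passage to the limit\<close>

definition inverse_closed_sum_free :: "nat \<Rightarrow> int set \<Rightarrow> bool" where
  "inverse_closed_sum_free p A \<longleftrightarrow>
     prime p \<and>
     A \<subseteq> carrier (prime_field p) - {\<zero>\<^bsub>prime_field p\<^esub>} \<and>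
     sum_free (prime_field p) A \<and>
     A = inverse_set (prime_field p) A"

text \<open>The parameters are chosen in the order \<epsilon>, N, \<delta>, k, M0, each from the
  previous ones and none from \<open>p\<close>; only the threshold \<open>P\<close> concerns the
  prime.\<close>

lemma eventually_density_bound:
  assumes "\<eta> > 0"
  shows "\<exists>P. \<forall>p\<ge>P. \<forall>A. inverse_closed_sum_free p A \<longrightarrow> real (card A) \<le> (1/9 + \<eta>) * real p"
proof -
  define \<epsilon> where "\<epsilon> = min (1/12) (\<eta> / 9)"
  have \<epsilon>: "0 < \<epsilon>" "\<epsilon> \<le> 1/12" "9 * \<epsilon> \<le> \<eta>"
    using assms by (auto simp: \<epsilon>_def)
  obtain N where N: "(1 - \<epsilon>) ^ N < \<epsilon> / 2"
    using real_arch_pow_inv[of "\<epsilon> / 2" "1 - \<epsilon>"] \<epsilon> by auto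
  \<comment> \<open>The summand 1 makes N^3 6 \<delta> strictly less than \<epsilon>^5.\<close>
  define \<delta> where "\<delta> = \<epsilon> ^ 5 / (6 * (real N ^ 3 + 1))"
  have N3: "1 < 6 * (y + 1)" if "0 \<le> y" for y :: real
    using that by simp
  have "\<epsilon> ^ 5 \<le> 1" using \<epsilon> by (intro power_le_one) auto
  then have "\<epsilon> ^ 5 < 6 * (real N ^ 3 + 1)"
    by (rule le_less_trans) (simp only: N3 zero_le_power of_nat_0_le_iff)
  then have \<delta>: "0 < \<delta>" "\<delta> < 1"
    using \<epsilon> by (auto simp: \<delta>_def divide_simps add_nonneg_pos)
  have "real N ^ 3 * (6 * \<delta>) < (real N ^ 3 + 1) * (6 * \<delta>)"
    using \<delta> by (intro mult_strict_right_mono) auto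
  also have "\<dots> = \<epsilon> ^ 5"
  proof -
    have "(y + 1) * (6 * (z / (6 * (y + 1)))) = z" if "0 \<le> y" for y z :: real
      using that by (simp add: field_simps)
    then show ?thesis by (simp only: \<delta>_def zero_le_power of_nat_0_le_iff)
  qed
  finally have \<delta>N: "real N ^ 3 * (6 * \<delta>) < \<epsilon> ^ 5" .
  define k where "k = nat \<lceil>1 / \<delta>\<^sup>2\<rceil>"
  have k: "1 / \<delta>\<^sup>2 \<le> real k" unfolding k_def by linarith
  have "((\<lambda>n. (1 - \<delta>) ^ n * (real n + 1) ^ k) \<longlongrightarrow> 0) at_top"
    using \<delta> by real_asymp
  then have "eventually (\<lambda>n. (1 - \<delta>) ^ n * (real n + 1) ^ k < 1) at_top"
    by (rule order_tendstoD) simp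
  then obtain M0 where M0: "(1 - \<delta>) ^ M0 * (real M0 + 1) ^ k < 1"
    by (auto simp: eventually_at_top_linorder)
  define C where "C = (1 + (1 + (real M0 + 1) ^ k) ^ N)\<^sup>2"
  have C: "C > 0"
    unfolding C_def
    by (intro zero_less_power add_pos_nonneg zero_le_power add_nonneg_nonneg) auto
  \<comment> \<open>The second bound is root 4 (3 p^3) C \<le> \<epsilon> p raised to the fourth
    power and solved for p.\<close>
  define P where "P = nat \<lceil>max (1 / \<epsilon>) (3 * C ^ 4 / \<epsilon> ^ 4)\<rceil>"
  show ?thesis
  proof (intro exI[of _ P] allI impI)
    fix p A assume "p \<ge> P" and A: "inverse_closed_sum_free p A"
    then have p: "1 / \<epsilon> \<le> real p" "3 * C ^ 4 / \<epsilon> ^ 4 \<le> real p"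
      unfolding P_def by linarith+
    interpret prime_fourier p
      by unfold_locales (use A in \<open>simp add: inverse_closed_sum_free_def\<close>)
    have carrier: "carrier (prime_field p) - {\<zero>\<^bsub>prime_field p\<^esub>} = Zpx"
      by (auto simp: residue_ring_def)
    have "3 * real p ^ 3 * C ^ 4 \<le> (\<epsilon> * real p) ^ 4"
    proof -
      have "3 * C ^ 4 \<le> real p * \<epsilon> ^ 4"
        using p(2) \<epsilon> by (simp add: field_simps)
      then have "real p ^ 3 * (3 * C ^ 4) \<le> real p ^ 3 * (real p * \<epsilon> ^ 4)"
        by (intro mult_left_mono) auto
      then show ?thesis by (simp add: power_mult_distrib eval_nat_numeral mult_ac)
    qed
    then have "root 4 (3 * real p ^ 3 * C ^ 4) \<le> root 4 ((\<epsilon> * real p) ^ 4)"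
      by simp
    then have K: "root 4 (3 * real p ^ 3) * C \<le> \<epsilon> * real p"
      using C \<epsilon> by (simp add: real_root_mult real_root_power_cancel)
    have "real (card A) \<le> (1/9 + 9 * \<epsilon>) * real p"
    proof (rule card_bound[OF _ _ _ \<epsilon>(1,2) less_imp_le[OF N] \<delta>(1) less_imp_le[OF \<delta>(2)] \<delta>N k M0 _ K[unfolded C_def]])
      show "A \<subseteq> Zpx"
        using A carrier by (simp add: inverse_closed_sum_free_def)
      show "(x + y) mod int p \<notin> A" if "x \<in> A" "y \<in> A" for x y
        using A that
        by (auto simp: inverse_closed_sum_free_def sum_free_def set_add_def' residue_ring_def)
      show "minv x \<in> A" if "x \<in> A" for x
        using A that by (auto simp: inverse_closed_sum_free_def inverse_set_def minv_def)
      show "1 \<le> \<epsilon> * real p"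
        using p(1) \<epsilon> by (simp add: field_simps)
    qed
    also have "\<dots> \<le> (1/9 + \<eta>) * real p"
      using \<epsilon>(3) by (intro mult_right_mono) auto
    finally show "real (card A) \<le> (1/9 + \<eta>) * real p" .
  qed
qed

theorem theorem3:
  shows "\<exists>err :: nat \<Rightarrow> real. err \<in> o[at_top](\<lambda>_. 1) \<and>
    (\<forall>(p :: nat) (A :: int set) (\<alpha> :: real).
       prime p \<longrightarrow>
       A \<subseteq> carrier (prime_field p) - {\<zero>\<^bsub>prime_field p\<^esub>} \<longrightarrow>
       real (card A) = \<alpha> * real p \<longrightarrow>
       sum_free (prime_field p) A \<longrightarrow>
       A = inverse_set (prime_field p) A \<longrightarrow>
       \<alpha> \<le> 1 / 9 + err p)"
proof -
  \<comment> \<open>The error is the largest excess over 1/9 among the finitely many admissible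
    sets. Inserting 0 gives a maximum also when there are none, as for composite \<open>p\<close>,
    and makes the error nonnegative, so only an upper bound remains to be shown.\<close>
  define D where "D p = insert 0 ((\<lambda>A. real (card A) / real p - 1/9) ` {A. inverse_closed_sum_free p A})"
    for p
  define err where "err p = Max (D p)" for p
  have fin: "finite (D p)" for p
  proof -
    have "finite {A. inverse_closed_sum_free p A}"
      by (rule finite_subset[of _ "Pow (carrier (prime_field p))"])
         (auto simp: inverse_closed_sum_free_def residue_ring_def)
    then show ?thesis by (simp add: D_def)
  qed
  have "(err \<longlongrightarrow> 0) at_top"
  proof (rule LIMSEQ_I)
    fix r :: real assume "r > 0"
    then obtain P where P:
      "\<And>p A. p \<ge> P \<Longrightarrow> inverse_closed_sum_free p A \<Longrightarrow> real (card A) \<le> (1/9 + r/2) * real p"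
      using eventually_density_bound[of "r/2"] by auto
    have "norm (err p - 0) < r" if "p \<ge> P" for p
    proof -
      have "err p \<le> r / 2"
        unfolding err_def
      proof (rule Max.boundedI[OF fin])
        fix d assume "d \<in> D p"
        then consider "d = 0" | A where "inverse_closed_sum_free p A" "d = real (card A) / real p - 1/9"
          by (auto simp: D_def)
        then show "d \<le> r / 2"
        proof cases
          case (2 A)
          then have "real p > 0"
            by (simp add: inverse_closed_sum_free_def prime_gt_0_nat)
          then have "real (card A) / real p \<le> 1/9 + r/2"
            using P[OF that 2(1)] by (simp only: pos_divide_le_eq)
          then show ?thesis using 2(2) by simp
        qed (use \<open>r > 0\<close> in simp)
      qed (simp add: D_def)
      moreover have "0 \<le> err p"
        unfolding err_def by (rule Max_ge[OF fin]) (simp add: D_def)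
      ultimately show ?thesis using \<open>r > 0\<close> by simp
    qed
    then show "\<exists>no. \<forall>n\<ge>no. norm (err n - 0) < r" by blast
  qed
  then have "err \<in> o[at_top](\<lambda>_. 1)"
    by (intro smalloI_tendsto) auto
  moreover have "\<alpha> \<le> 1 / 9 + err p"
    if "inverse_closed_sum_free p A" "real (card A) = \<alpha> * real p" for p A \<alpha>
  proof -
    have "real p > 0" using that(1) by (simp add: inverse_closed_sum_free_def prime_gt_0_nat)
    then have "\<alpha> = real (card A) / real p" using that(2) by simp
    moreover have "real (card A) / real p - 1/9 \<le> err p"
      unfolding err_def by (rule Max_ge[OF fin]) (use that(1) in \<open>auto simp: D_def\<close>)
    ultimately show ?thesis by simp
  qed
  ultimately show ?thesis
    unfolding inverse_closed_sum_free_def by blast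
qed

end
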